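(* Let $X,Y\subseteq\omega$ be coinfinite primitive recursive sets. If $X$ is slow and $Y$ is not slow, then the lowercones $\{\deg(R_Z)\mid R_Z\leq_{pr}R_X\}$ and $\{\deg(R_Z)\mid R_Z\leq_{pr}R_Y\}$ of $\mathbf{Peq}$ are not isomorphic as posets.
   Context: A punctual equivalence relation is a primitive recursive equivalence relation with domain $\omega$ having infinitely many equivalence classes. For equivalence relations $R,S$ on $\omega$, $R\leq_{pr} S$ means that there is a primitive recursive function $f:\omega\to\omega$ such that for all $x,y\in\omega$, $x\mathrel{R}y \Leftrightarrow f(x)\mathrel{S}f(y)$. Write $R\equiv_{pr}S$ if $R\leq_{pr}S$ and $S\leq_{pr}R$. $\mathbf{Peq}$ is the partial order of $\equiv_{pr}$-classes $\deg(R)$ of punctual equivalence relations $R$, ordered by the order induced by $\leq_{pr}$. For $X\subseteq\omega$, $R_X$ is given by $x\mathrel{R_X}y \Leftrightarrow (x,y\in X \text{ or } x=y)$. In the lowercones, $R_Z$ ranges over punctual equivalence relations with $Z\subseteq\omega$ primitive recursive; every punctual equivalence relation is $\equiv_{pr}$-equivalent to one of this form. For coinfinite $X$, $p_{\overline{X}}(n)$ denotes the $n$-th element of the complement $\overline{X}$ in increasing order. A coinfinite primitive recursive set $X$ is slow if for every primitive recursive function $r$, $p_{\overline{X}}(n+1)>r(p_{\overline{X}}(n))$ holds for all but finitely many $n$. *)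

theory Defs
  imports "HOL-Library.Infinite_Set"
begin

(* A k-ary function on nat is represented by a function on lists, of which only the
   values on lists of length k matter.  In Rec, the recursion argument is the head
   of the list, and the step function receives the predecessor m of the recursion
   argument, the previous value r, and the parameters, in this order. *)

inductive prim_rec :: "nat \<Rightarrow> (nat list \<Rightarrow> nat) \<Rightarrow> bool" where
  Zero: "prim_rec k (\<lambda>xs. 0)"
| Succ: "prim_rec 1 (\<lambda>xs. Suc (xs ! 0))"
| Proj: "i < k \<Longrightarrow> prim_rec k (\<lambda>xs. xs ! i)"
| Comp: "prim_rec (length gs) f \<Longrightarrow> \<forall>g\<in>set gs. prim_rec k g \<Longrightarrow>
    prim_rec k (\<lambda>xs. f (map (\<lambda>g. g xs) gs))"
| Rec: "prim_rec k f \<Longrightarrow> prim_rec (Suc (Suc k)) g \<Longrightarrow>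
    prim_rec (Suc k)
      (\<lambda>xs. rec_nat (f (tl xs)) (\<lambda>m r. g (m # r # tl xs)) (hd xs))"

definition prim_rec1 :: "(nat \<Rightarrow> nat) \<Rightarrow> bool" where
  "prim_rec1 f \<longleftrightarrow> (\<exists>F. prim_rec 1 F \<and> (\<forall>x. F [x] = f x))"

definition prim_rec_set :: "nat set \<Rightarrow> bool" where
  "prim_rec_set X \<longleftrightarrow> prim_rec1 (\<lambda>x. if x \<in> X then 1 else 0)"

definition prim_rec_rel :: "(nat \<times> nat) set \<Rightarrow> bool" where
  "prim_rec_rel R \<longleftrightarrow>
    (\<exists>F. prim_rec 2 F \<and> (\<forall>x y. F [x, y] = (if (x, y) \<in> R then 1 else 0)))"

definition punctual :: "(nat \<times> nat) set \<Rightarrow> bool" where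
  "punctual R \<longleftrightarrow> equiv UNIV R \<and> prim_rec_rel R \<and> infinite (UNIV // R)"

definition pr_le :: "(nat \<times> nat) set \<Rightarrow> (nat \<times> nat) set \<Rightarrow> bool" (infix "\<le>pr" 50) where
  "R \<le>pr S \<longleftrightarrow> (\<exists>f. prim_rec1 f \<and> (\<forall>x y. (x, y) \<in> R \<longleftrightarrow> (f x, f y) \<in> S))"

definition pr_equiv :: "((nat \<times> nat) set \<times> (nat \<times> nat) set) set" where
  "pr_equiv = {(R, S). punctual R \<and> punctual S \<and> R \<le>pr S \<and> S \<le>pr R}"

definition Peq :: "(nat \<times> nat) set set set" where
  "Peq = Collect punctual // pr_equiv"

definition deg :: "(nat \<times> nat) set \<Rightarrow> (nat \<times> nat) set set" where
  "deg R = pr_equiv `` {R}"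

(* The order on degrees does not depend on the representatives, see deg_le_deg_iff. *)

definition deg_le :: "(nat \<times> nat) set set \<Rightarrow> (nat \<times> nat) set set \<Rightarrow> bool" where
  "deg_le a b \<longleftrightarrow> (\<exists>R\<in>a. \<exists>S\<in>b. R \<le>pr S)"

definition R_of :: "nat set \<Rightarrow> (nat \<times> nat) set" where
  "R_of X = {(x, y). x \<in> X \<and> y \<in> X \<or> x = y}"

definition lowercone :: "nat set \<Rightarrow> (nat \<times> nat) set set set" where
  "lowercone X = {deg (R_of Z) |Z. prim_rec_set Z \<and> punctual (R_of Z) \<and> R_of Z \<le>pr R_of X}"

(* enumerate (- X) n is the n-th element of the complement of X, counting from 0. *)

definition slow :: "nat set \<Rightarrow> bool" where
  "slow X \<longleftrightarrow> infinite (- X) \<and> prim_rec_set X \<and>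
    (\<forall>r. prim_rec1 r \<longrightarrow>
      (\<forall>\<^sub>\<infinity>n. enumerate (- X) (Suc n) > r (enumerate (- X) n)))"

definition poset_iso ::
    "('a \<Rightarrow> 'a \<Rightarrow> bool) \<Rightarrow> 'a set \<Rightarrow> ('b \<Rightarrow> 'b \<Rightarrow> bool) \<Rightarrow> 'b set \<Rightarrow> ('a \<Rightarrow> 'b) \<Rightarrow> bool" where
  "poset_iso le A le' B h \<longleftrightarrow>
    bij_betw h A B \<and> (\<forall>a\<in>A. \<forall>b\<in>A. le a b \<longleftrightarrow> le' (h a) (h b))"

lemma pr_le_refl: "R \<le>pr R"
proof -
  have "prim_rec1 (\<lambda>x. x)"
    unfolding prim_rec1_def using prim_rec.Proj[of 0 1] by fastforce
  then show ?thesis unfolding pr_le_def by blast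
qed

lemma prim_rec1_comp:
  assumes "prim_rec1 f" "prim_rec1 g"
  shows "prim_rec1 (\<lambda>x. g (f x))"
proof -
  from assms obtain F G where F: "prim_rec 1 F" "\<And>x. F [x] = f x"
    and G: "prim_rec 1 G" "\<And>x. G [x] = g x"
    unfolding prim_rec1_def by blast
  have "prim_rec 1 (\<lambda>xs. G (map (\<lambda>g. g xs) [F]))"
    using prim_rec.Comp[of "[F]" G 1] F(1) G(1) by simp
  then show ?thesis
    unfolding prim_rec1_def using F(2) G(2) by (intro exI conjI) auto
qed

lemma pr_le_trans: "R \<le>pr S \<Longrightarrow> S \<le>pr T \<Longrightarrow> R \<le>pr T"
proof -
  assume "R \<le>pr S" "S \<le>pr T"
  then obtain f g where "prim_rec1 f" "\<And>x y. (x, y) \<in> R \<longleftrightarrow> (f x, f y) \<in> S"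
    and "prim_rec1 g" "\<And>x y. (x, y) \<in> S \<longleftrightarrow> (g x, g y) \<in> T"
    unfolding pr_le_def by blast
  then show ?thesis
    unfolding pr_le_def by (intro exI[of _ "\<lambda>x. g (f x)"]) (simp add: prim_rec1_comp)
qed

lemma equiv_pr_equiv: "equiv (Collect punctual) pr_equiv"
  by (auto simp: equiv_def pr_equiv_def refl_on_def sym_on_def
      intro!: transI intro: pr_le_refl pr_le_trans)

lemma deg_le_deg_iff:
  assumes "punctual R" "punctual S"
  shows "deg_le (deg R) (deg S) \<longleftrightarrow> R \<le>pr S"
  using assms unfolding deg_le_def deg_def pr_equiv_def
  by (auto intro: pr_le_refl pr_le_trans)

lemma lowercone_subset_Peq: "lowercone X \<subseteq> Peq"
  unfolding lowercone_def Peq_def deg_def quotient_def by blast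

end

theory Submission
  imports Defs
begin

text \<open>
  Up to equivalence, \<open>R_of Z\<close> is determined by how fast the complement of \<open>Z\<close> is enumerated. Let \<open>cnt Z v\<close>
  be the number of elements up to \<open>v\<close> outside \<open>Z\<close>. Then \<open>R_of Z\<close> reduces to \<open>R_of W\<close> if and only if \<open>cnt W\<close>
  catches up with \<open>cnt Z\<close> after a primitive recursive delay (\<open>R_of_le_iff\<close>). Conversely, every monotone
  unbounded primitive recursive function, called a rate here, is equivalent to such a counting function.
  So the lower cone of \<open>X\<close> is the order of the rates below \<open>k = cnt X\<close> modulo equivalence (\<open>lowercone_eq_image\<close>,
  \<open>deg_le_set_of_rate_iff\<close>). It is a lattice with pointwise maximum and minimum and with top \<open>k\<close>.

  The two cones are told apart by an order-theoretic property, \<open>splits\<close>. It considers all decompositions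
  of the top as a supremum of two smaller elements \<open>a\<close> and \<open>b\<close> whose infimum is superfluous, that is, never
  helps to complete an element to the top. It demands a regular element \<open>u\<close> (the least completion of some
  element to the top) below \<open>a\<close>, and an \<open>f\<close> above \<open>u\<close> that is not below \<open>a\<close> but exceeds \<open>u\<close> only a little,
  in the sense that the differences of any two elements below \<open>f\<close> are disjoint modulo \<open>u\<close>.

  If \<open>X\<close> is slow, then after an element of the complement no other one appears within any given
  primitive recursive delay, apart from finitely many exceptions. Every decomposition then comes from a
  partition of the complement of \<open>X\<close> into the elements \<open>S\<close> at which \<open>a\<close> catches up with \<open>k\<close> and the others,
  and \<open>u\<close> can follow \<open>k\<close> exactly on \<open>S\<close>. At the next element after one of \<open>S\<close>, the rate \<open>u\<close> is at most one behind,
  so \<open>f = min k (u + 1)\<close> is not below \<open>a\<close>, and the step from \<open>u\<close> to \<open>f\<close> has height one. Such steps are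
  narrow (\<open>narrow_if_step\<close>, \<open>splits_if_slow\<close>).

  If \<open>Y\<close> is not slow, there are infinitely many elements of the complement whose successor is found within a
  fixed pace. Choose sparse marks among them, spaced by the enumeration of the slow set \<open>X\<close>, and let \<open>a\<close>
  and \<open>b\<close> follow \<open>k\<close> and rest in turn between the marks. A rest begins at the first of two close elements.
  A regular element \<open>u\<close> below \<open>a\<close> cannot distinguish the two, because a primitive recursive delay leads
  from the first to the second, so it misses both and remains below \<open>k s\<close> during the rest after a mark \<open>s\<close>.
  An \<open>f\<close> that is not below \<open>a\<close> exceeds \<open>k s\<close> during such a rest. Hence the step from \<open>u\<close> to \<open>f\<close> has
  height two, and it persists for longer than any pace (\<open>not_splits_if_not_slow\<close>). Such a step is not
  narrow (\<open>wide.not_narrow\<close>). This is a diagonalisation against all primitive recursive delays. An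
  Ackermann hierarchy with primitive recursive graph supplies the delays to diagonalise with.
\<close>

section \<open>Closure properties of primitive recursive functions\<close>

text \<open>
  A \<open>k\<close>-ary function given by its values on lists of length \<open>k\<close>. Passing to a predicate that ignores
  all other lists makes the closure properties below usable as introduction rules on terms.
\<close>

definition PR :: "nat \<Rightarrow> (nat list \<Rightarrow> nat) \<Rightarrow> bool" where
  "PR k F \<longleftrightarrow> (\<exists>G. prim_rec k G \<and> (\<forall>xs. length xs = k \<longrightarrow> G xs = F xs))"

lemma prim_rec1_iff: "prim_rec1 f \<longleftrightarrow> PR 1 (\<lambda>xs. f (xs ! 0))"
proof
  assume "prim_rec1 f"
  then obtain F where F: "prim_rec 1 F" "\<And>x. F [x] = f x" unfolding prim_rec1_def by blast
  have "\<forall>xs. length xs = 1 \<longrightarrow> F xs = f (xs ! 0)"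
    using F(2) by (metis One_nat_def length_0_conv length_Suc_conv nth_Cons_0)
  then show "PR 1 (\<lambda>xs. f (xs ! 0))" unfolding PR_def using F(1) by blast
next
  assume "PR 1 (\<lambda>xs. f (xs ! 0))"
  then obtain G where "prim_rec 1 G" "\<And>xs. length xs = 1 \<Longrightarrow> G xs = f (xs ! 0)"
    unfolding PR_def by blast
  then show "prim_rec1 f" unfolding prim_rec1_def by (intro exI[of _ G]) auto
qed

lemma PR_cong: "(\<And>xs. length xs = k \<Longrightarrow> F xs = F' xs) \<Longrightarrow> PR k F \<Longrightarrow> PR k F'"
  unfolding PR_def by (metis (no_types, lifting))

lemma PR_compose:
  assumes f: "PR (length gs) f" and gs: "\<And>g. g \<in> set gs \<Longrightarrow> PR k g"
  shows "PR k (\<lambda>xs. f (map (\<lambda>g. g xs) gs))"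
proof -
  obtain F where F: "prim_rec (length gs) F" "\<And>ys. length ys = length gs \<Longrightarrow> F ys = f ys"
    using f unfolding PR_def by blast
  obtain H where H: "\<And>g. g \<in> set gs \<Longrightarrow> prim_rec k (H g) \<and> (\<forall>xs. length xs = k \<longrightarrow> H g xs = g xs)"
    using gs unfolding PR_def by metis
  have "prim_rec k (\<lambda>xs. F (map (\<lambda>g. g xs) (map H gs)))"
    using F(1) H by (intro prim_rec.Comp) auto
  moreover have "F (map (\<lambda>g. g xs) (map H gs)) = f (map (\<lambda>g. g xs) gs)" if "length xs = k" for xs
  proof -
    have "map (\<lambda>g. g xs) (map H gs) = map (\<lambda>g. g xs) gs" using H that by simp
    then show ?thesis using F(2)[of "map (\<lambda>g. g xs) gs"] by (metis length_map)
  qed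
  ultimately show ?thesis unfolding PR_def by blast
qed

lemma PR_nth: "i < k \<Longrightarrow> PR k (\<lambda>xs. xs ! i)"
  unfolding PR_def using prim_rec.Proj by blast

lemma PR_nth_drop: "j + i < k \<Longrightarrow> PR k (\<lambda>xs. drop j xs ! i)"
  by (rule PR_cong[OF _ PR_nth[of "j + i"]]) auto

lemma PR_nth_tl: "Suc i < k \<Longrightarrow> PR k (\<lambda>xs. tl xs ! i)"
  by (rule PR_cong[OF _ PR_nth[of "Suc i"]]) (auto simp: nth_tl)

abbreviation "pr2 f \<equiv> PR 2 (\<lambda>xs. f (xs ! 0) (xs ! Suc 0))"
abbreviation "pr3 f \<equiv> PR 3 (\<lambda>xs. f (xs ! 0) (xs ! Suc 0) (xs ! Suc (Suc 0)))"
abbreviation "pr4 f \<equiv> PR 4 (\<lambda>xs. f (xs ! 0) (xs ! Suc 0) (xs ! Suc (Suc 0)) (xs ! Suc (Suc (Suc 0))))"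

lemma PR_app1:
  assumes "prim_rec1 f" "PR k a"
  shows "PR k (\<lambda>xs. f (a xs))"
proof -
  have "PR k (\<lambda>xs. (\<lambda>ys. f (ys ! 0)) (map (\<lambda>g. g xs) [a]))"
    using assms by (intro PR_compose) (simp_all add: prim_rec1_iff)
  then show ?thesis by simp
qed

lemma PR_app2:
  assumes "pr2 f" "PR k a" "PR k b"
  shows "PR k (\<lambda>xs. f (a xs) (b xs))"
proof -
  have "PR (length [a, b]) (\<lambda>ys. f (ys ! 0) (ys ! Suc 0))"
    using assms(1) by (simp add: eval_nat_numeral)
  then have "PR k (\<lambda>xs. (\<lambda>ys. f (ys ! 0) (ys ! Suc 0)) (map (\<lambda>g. g xs) [a, b]))"
    by (rule PR_compose) (use assms in auto)
  then show ?thesis by simp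
qed

lemma PR_app3:
  assumes "pr3 f" "PR k a" "PR k b" "PR k c"
  shows "PR k (\<lambda>xs. f (a xs) (b xs) (c xs))"
proof -
  have "PR (length [a, b, c]) (\<lambda>ys. f (ys ! 0) (ys ! Suc 0) (ys ! Suc (Suc 0)))"
    using assms(1) by (simp add: eval_nat_numeral)
  then have "PR k (\<lambda>xs. (\<lambda>ys. f (ys ! 0) (ys ! Suc 0) (ys ! Suc (Suc 0))) (map (\<lambda>g. g xs) [a, b, c]))"
    by (rule PR_compose) (use assms in auto)
  then show ?thesis by simp
qed

lemma PR_app4:
  assumes "pr4 f" "PR k a" "PR k b" "PR k c" "PR k d"
  shows "PR k (\<lambda>xs. f (a xs) (b xs) (c xs) (d xs))"
proof -
  have "PR (length [a, b, c, d])
      (\<lambda>ys. f (ys ! 0) (ys ! Suc 0) (ys ! Suc (Suc 0)) (ys ! Suc (Suc (Suc 0))))"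
    using assms(1) by (simp add: eval_nat_numeral)
  then have "PR k (\<lambda>xs. (\<lambda>ys. f (ys ! 0) (ys ! Suc 0) (ys ! Suc (Suc 0)) (ys ! Suc (Suc (Suc 0))))
      (map (\<lambda>g. g xs) [a, b, c, d]))"
    by (rule PR_compose) (use assms in auto)
  then show ?thesis by simp
qed

lemma prim_rec1_Suc: "prim_rec1 Suc"
  unfolding prim_rec1_iff PR_def using prim_rec.Succ by auto

lemma PR_Suc: "PR k a \<Longrightarrow> PR k (\<lambda>xs. Suc (a xs))"
  by (rule PR_app1[OF prim_rec1_Suc])

lemma PR_const: "PR k (\<lambda>xs. c)"
proof (induction c)
  case 0
  show ?case unfolding PR_def using prim_rec.Zero by blast
qed (rule PR_Suc)

text \<open>
  The recursor of the definition takes its recursion argument at the head of the list; here that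
  argument and the initial value may be any primitive recursive functions of the parameters.
\<close>

lemma PR_rec:
  assumes a: "PR k a" and n: "PR k n"
    and s: "PR (Suc (Suc k)) (\<lambda>ys. s (ys ! 0) (ys ! Suc 0) (drop 2 ys))"
  shows "PR k (\<lambda>xs. rec_nat (a xs) (\<lambda>m r. s m r xs) (n xs))"
proof -
  obtain A where A: "prim_rec k A" "\<And>xs. length xs = k \<Longrightarrow> A xs = a xs"
    using a unfolding PR_def by blast
  obtain S where S: "prim_rec (Suc (Suc k)) S"
    "\<And>ys. length ys = Suc (Suc k) \<Longrightarrow> S ys = s (ys ! 0) (ys ! Suc 0) (drop 2 ys)"
    using s unfolding PR_def by blast
  have "prim_rec (Suc k) (\<lambda>xs. rec_nat (A (tl xs)) (\<lambda>m r. S (m # r # tl xs)) (hd xs))"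
    by (rule prim_rec.Rec[OF A(1) S(1)])
  then have R: "PR (Suc k) (\<lambda>xs. rec_nat (A (tl xs)) (\<lambda>m r. S (m # r # tl xs)) (hd xs))"
    unfolding PR_def by blast
  have "PR k (\<lambda>xs. (\<lambda>xs. rec_nat (A (tl xs)) (\<lambda>m r. S (m # r # tl xs)) (hd xs))
      (map (\<lambda>g. g xs) (n # map (\<lambda>i xs. xs ! i) [0..<k])))"
    using R n by (intro PR_compose) (auto intro: PR_nth)
  then show ?thesis
  proof (rule PR_cong[rotated])
    fix xs :: "nat list" assume k: "length xs = k"
    have "map (\<lambda>x. xs ! x) [0..<k] = xs" using k map_nth[of xs] by simp
    then have [simp]: "map ((\<lambda>g. g xs) \<circ> (\<lambda>i xs. xs ! i)) [0..<k] = xs" by (simp add: comp_def)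
    show "(\<lambda>xs. rec_nat (A (tl xs)) (\<lambda>m r. S (m # r # tl xs)) (hd xs))
      (map (\<lambda>g. g xs) (n # map (\<lambda>i xs. xs ! i) [0..<k])) = rec_nat (a xs) (\<lambda>m r. s m r xs) (n xs)"
      using A(2) S(2) k by simp
  qed
qed

lemma prim_rec1_rec:
  assumes "f 0 = c" "\<And>n. f (Suc n) = s n (f n)" "pr2 s"
  shows "prim_rec1 f"
proof -
  have f: "f n = rec_nat c (\<lambda>m r. s m r) n" for n by (induction n) (use assms in auto)
  have "PR 1 (\<lambda>xs. rec_nat c (\<lambda>m r. s m r) (xs ! 0))"
    by (intro PR_rec PR_const PR_nth PR_app2[OF assms(3)]) auto
  then show ?thesis unfolding prim_rec1_iff f .
qed

lemma pr2_rec: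
  assumes "\<And>x. f 0 x = a x" "\<And>n x. f (Suc n) x = s n (f n x) x" "prim_rec1 a" "pr3 s"
  shows "pr2 f"
proof -
  have f: "f n x = rec_nat (a x) (\<lambda>m r. s m r x) n" for n x by (induction n) (use assms in auto)
  have "pr2 (\<lambda>n x. rec_nat (a x) (\<lambda>m r. s m r x) n)"
    by (rule PR_rec; intro PR_app1[OF assms(3)] PR_app3[OF assms(4)] PR_nth PR_nth_drop) auto
  then show ?thesis unfolding f .
qed

lemma PR_add: "PR k a \<Longrightarrow> PR k b \<Longrightarrow> PR k (\<lambda>xs. a xs + b xs)"
proof (rule PR_app2[of "(+)"])
  show "pr2 (+)" by (rule pr2_rec[of _ "\<lambda>x. x" "\<lambda>n r x. Suc r"])
      (auto simp: prim_rec1_iff intro!: PR_Suc PR_nth)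
qed

lemma PR_mult: "PR k a \<Longrightarrow> PR k b \<Longrightarrow> PR k (\<lambda>xs. a xs * b xs)"
proof (rule PR_app2[of "(*)"])
  show "pr2 (*)" by (rule pr2_rec[of _ "\<lambda>x. 0" "\<lambda>n r x. x + r"])
      (auto simp: prim_rec1_iff intro!: PR_add PR_nth PR_const)
qed

lemma PR_pred: "PR k a \<Longrightarrow> PR k (\<lambda>xs. a xs - Suc 0)"
proof (rule PR_app1[of "\<lambda>x. x - Suc 0"])
  show "prim_rec1 (\<lambda>x. x - Suc 0)" by (rule prim_rec1_rec[of _ 0 "\<lambda>n r. n"]) (auto intro: PR_nth)
qed

lemma PR_diff: "PR k a \<Longrightarrow> PR k b \<Longrightarrow> PR k (\<lambda>xs. a xs - b xs)"
proof (rule PR_app2[of "\<lambda>b a. a - b"])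
  show "pr2 (\<lambda>b a. a - b)" by (rule pr2_rec[of _ "\<lambda>x. x" "\<lambda>n r x. r - Suc 0"])
      (auto simp: prim_rec1_iff intro!: PR_pred PR_nth)
qed

lemma PR_power: "PR k a \<Longrightarrow> PR k b \<Longrightarrow> PR k (\<lambda>xs. a xs ^ b xs)"
proof (rule PR_app2[of "\<lambda>b a. a ^ b"])
  show "pr2 (\<lambda>b a. a ^ b)" by (rule pr2_rec[of _ "\<lambda>x. 1" "\<lambda>n r x. x * r"])
      (auto simp: prim_rec1_iff intro!: PR_mult PR_nth PR_const)
qed

definition PRP :: "nat \<Rightarrow> (nat list \<Rightarrow> bool) \<Rightarrow> bool" where
  "PRP k P \<longleftrightarrow> PR k (\<lambda>xs. if P xs then 1 else 0)"

lemma PRP_not: "PRP k P \<Longrightarrow> PRP k (\<lambda>xs. \<not> P xs)"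
  unfolding PRP_def by (drule PR_diff[OF PR_const[of _ 1]], erule PR_cong[rotated]) auto

lemma PRP_conj: "PRP k P \<Longrightarrow> PRP k Q \<Longrightarrow> PRP k (\<lambda>xs. P xs \<and> Q xs)"
  unfolding PRP_def by (drule (1) PR_mult, erule PR_cong[rotated]) auto

lemma PRP_disj: "PRP k P \<Longrightarrow> PRP k Q \<Longrightarrow> PRP k (\<lambda>xs. P xs \<or> Q xs)"
  using PRP_not[OF PRP_conj[OF PRP_not PRP_not, of k P Q]] by simp

lemma PRP_le: "PR k a \<Longrightarrow> PR k b \<Longrightarrow> PRP k (\<lambda>xs. a xs \<le> b xs)"
  unfolding PRP_def
  by (drule (1) PR_diff, drule PR_diff[OF PR_const[of _ 1]], erule PR_cong[rotated]) auto

lemma PRP_less: "PR k a \<Longrightarrow> PR k b \<Longrightarrow> PRP k (\<lambda>xs. a xs < b xs)"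
  using PRP_not[OF PRP_le[of k b a]] by (simp add: not_le)

lemma PRP_eq: "PR k a \<Longrightarrow> PR k b \<Longrightarrow> PRP k (\<lambda>xs. a xs = b xs)"
  using PRP_conj[OF PRP_le[of k a b] PRP_le[of k b a]] by (simp add: eq_iff)

lemma PRP_in: "prim_rec_set S \<Longrightarrow> PR k a \<Longrightarrow> PRP k (\<lambda>xs. a xs \<in> S)"
  unfolding prim_rec_set_def PRP_def by (rule PR_app1)

lemma PR_if:
  assumes "PRP k P" "PR k a" "PR k b"
  shows "PR k (\<lambda>xs. if P xs then a xs else b xs)"
proof -
  have "PR k (\<lambda>xs. (if P xs then 1 else 0) * a xs + (1 - (if P xs then 1 else 0)) * b xs)"
    using assms unfolding PRP_def by (intro PR_add PR_mult PR_diff PR_const)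
  then show ?thesis by (rule PR_cong[rotated]) auto
qed

lemma PR_min: "PR k a \<Longrightarrow> PR k b \<Longrightarrow> PR k (\<lambda>xs. min (a xs) (b xs))"
  unfolding min_def by (intro PR_if PRP_le)

lemma PR_max: "PR k a \<Longrightarrow> PR k b \<Longrightarrow> PR k (\<lambda>xs. max (a xs) (b xs))"
  unfolding max_def by (intro PR_if PRP_le)

lemma PR_sum:
  assumes n: "PR k n" and s: "PR (Suc k) (\<lambda>ys. s (ys ! 0) (tl ys))"
  shows "PR k (\<lambda>xs. \<Sum>i<n xs. s i xs)"
proof -
  have eq: "(\<Sum>i<m. s i xs) = rec_nat 0 (\<lambda>i r. r + s i xs) m" for m xs
    by (induction m) auto
  have "PR (Suc (Suc k)) (\<lambda>xs. (\<lambda>ys. s (ys ! 0) (tl ys)) (map (\<lambda>g. g xs)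
      ((\<lambda>xs. xs ! 0) # map (\<lambda>i xs. xs ! (2 + i)) [0..<k])))"
    using s by (intro PR_compose) (auto intro: PR_nth)
  then have "PR (Suc (Suc k)) (\<lambda>ys. s (ys ! 0) (drop 2 ys))"
  proof (rule PR_cong[rotated])
    fix xs :: "nat list" assume k: "length xs = Suc (Suc k)"
    have "map ((\<lambda>g. g xs) \<circ> (\<lambda>i xs. xs ! (2 + i))) [0..<k] = drop 2 xs"
      using k by (intro nth_equalityI) auto
    then show "(\<lambda>ys. s (ys ! 0) (tl ys)) (map (\<lambda>g. g xs)
      ((\<lambda>xs. xs ! 0) # map (\<lambda>i xs. xs ! (2 + i)) [0..<k])) = s (xs ! 0) (drop 2 xs)" by simp
  qed
  then show ?thesis unfolding eq
    by (intro PR_rec PR_const n PR_add PR_nth) auto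
qed

text \<open>
  Division becomes a bounded sum, because \<open>m div n\<close> is the number of positive multiples of \<open>n\<close> up to \<open>m\<close>.
\<close>

lemma div_eq_sum: "(\<Sum>i<m. if Suc i * n \<le> m then 1 else 0) = (if n = 0 then m else m div n)" for m n :: nat
proof (cases "n = 0")
  case False
  have "{i. i < m \<and> Suc i * n \<le> m} = {..<m div n}"
  proof -
    have "Suc i * n \<le> m \<longleftrightarrow> i < m div n" for i
      using False less_eq_div_iff_mult_less_eq[of n "Suc i" m] by (simp add: Suc_le_eq)
    moreover have "i < m" if "i < m div n" for i using that by (meson div_le_dividend less_le_trans)
    ultimately show ?thesis by auto
  qed
  then show ?thesis using False
    by (simp add: sum.If_cases Int_def lessThan_def)
qed simp

lemma PR_div:
  assumes a: "PR k a" and b: "PR k b" shows "PR k (\<lambda>xs. a xs div b xs)"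
proof (rule PR_app2[OF _ a b])
  have "pr2 (\<lambda>m n. if n = 0 then 0 else (\<Sum>i<m. if Suc i * n \<le> m then 1 else 0))"
    by (intro PR_if PRP_eq PR_const PR_nth PR_sum PRP_le PR_mult PR_Suc PR_nth_tl) auto
  then show "pr2 (div)"
    by (rule PR_cong[rotated]) (auto simp only: div_eq_sum div_by_0 split: if_splits)
qed

lemma PR_mod:
  assumes "PR k a" "PR k b" shows "PR k (\<lambda>xs. a xs mod b xs)"
  using PR_diff[OF assms(1) PR_mult[OF assms(2) PR_div[OF assms]]]
  by (simp add: minus_mult_div_eq_mod)

lemmas PR_intros = PR_nth PR_nth_drop PR_nth_tl PR_const PR_Suc PR_add PR_mult PR_diff PR_power PR_div PR_mod
  PR_if PR_min PR_max PRP_le PRP_less PRP_eq PRP_not PRP_conj PRP_disj PRP_in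

section \<open>An Ackermann hierarchy with primitive recursive graph\<close>

text \<open>
  A hierarchy of Ackermann type. Iterating \<open>v + 2\<close> times rather than \<open>v\<close> times lets level \<open>k + 1\<close> dominate
  two applications of level \<open>k\<close> at every argument, including \<open>0\<close>.
\<close>

primrec ack :: "nat \<Rightarrow> nat \<Rightarrow> nat" where
  "ack 0 = Suc"
| "ack (Suc k) = (\<lambda>v. (ack k ^^ Suc (Suc v)) v)"

lemma funpow_infl: "(\<And>v. v < f v) \<Longrightarrow> (v::nat) + n \<le> (f ^^ n) v"
  by (induction n) (auto, metis Suc_leI le_trans not_less_eq_eq)

lemma ack_infl: "v < ack k v"
proof (induction k arbitrary: v)
  case (Suc k)
  then show ?case using funpow_infl[of "ack k" v "Suc (Suc v)"] by simp
qed simp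

lemma funpow_mono_le: "mono f \<Longrightarrow> (\<And>v. v \<le> f v) \<Longrightarrow> m \<le> n \<Longrightarrow> u \<le> (v::nat) \<Longrightarrow> (f ^^ m) u \<le> (f ^^ n) v"
proof -
  assume f: "mono f" "\<And>v. v \<le> f v" and "m \<le> n" "u \<le> v"
  have "(f ^^ m) u \<le> (f ^^ m) v" by (rule funpow_mono[OF f(1) \<open>u \<le> v\<close>])
  also have "\<dots> \<le> (f ^^ n) v"
    using \<open>m \<le> n\<close> by (induction n rule: dec_induct) (auto intro: order_trans f(2))
  finally show ?thesis .
qed

lemma ack_mono: "mono (ack k)"
proof (induction k)
  case 0
  show ?case by (simp add: mono_def)
next
  case (Suc k)
  show ?case unfolding mono_def ack.simps
    by (intro allI impI funpow_mono_le[OF Suc]) (auto intro: less_imp_le ack_infl)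
qed

lemma ack_monoD: "u \<le> v \<Longrightarrow> ack k u \<le> ack k v"
  using ack_mono by (rule monoD)

lemma ack_twice: "ack k (ack k v) \<le> ack (Suc k) v"
proof -
  have "(ack k ^^ 2) v \<le> (ack k ^^ Suc (Suc v)) v"
    by (intro funpow_mono_le[OF ack_mono]) (auto intro: less_imp_le ack_infl)
  then show ?thesis by (simp add: numeral_2_eq_2)
qed

lemma ack_level_mono: "k \<le> l \<Longrightarrow> ack k v \<le> ack l v"
proof (induction l rule: dec_induct)
  case (step l)
  then show ?case using ack_twice[of l v] ack_infl[of "ack l v" l] by linarith
qed simp

definition max_arg :: "nat list \<Rightarrow> nat" where "max_arg xs = Max (insert 0 (set xs))"

lemma max_arg_le: "max_arg xs \<le> c \<longleftrightarrow> (\<forall>x\<in>set xs. x \<le> c)" by (simp add: max_arg_def)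

text \<open>
  Each level absorbs one use of composition or recursion: a composition of functions below level \<open>n\<close> is
  below \<open>n\<close> applied twice, and recursion up to \<open>n \<le> V\<close> with a step below level \<open>m\<close> is below an
  \<open>m\<close>-iterate of length at most \<open>V + 2\<close>. Both are below the next level.
\<close>

lemma prim_rec_below_ack: "prim_rec k f \<Longrightarrow> \<exists>m. \<forall>xs. length xs = k \<longrightarrow> f xs \<le> ack m (max_arg xs)"
proof (induction rule: prim_rec.induct)
  case (Zero k)
  show ?case by simp
next
  case Succ
  have "Suc (xs ! 0) \<le> ack 0 (max_arg xs)" if "length xs = 1" for xs
    using that max_arg_le[of xs "max_arg xs"] by (cases xs) auto
  then show ?case by blast
next
  case (Proj i k)
  have "xs ! i \<le> ack 0 (max_arg xs)" if "length xs = k" for xs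
    using that Proj max_arg_le[of xs "max_arg xs"] by (auto simp: le_SucI)
  then show ?case by blast
next
  case (Comp gs f k)
  obtain m where m: "\<And>xs. length xs = length gs \<Longrightarrow> f xs \<le> ack m (max_arg xs)" using Comp.IH by blast
  obtain M where M: "\<And>g xs. g \<in> set gs \<Longrightarrow> length xs = k \<Longrightarrow> g xs \<le> ack (M g) (max_arg xs)"
    using Comp.IH by metis
  define n where "n = Max (insert m (M ` set gs))"
  have n: "m \<le> n" "\<And>g. g \<in> set gs \<Longrightarrow> M g \<le> n" by (auto simp: n_def)
  have "f (map (\<lambda>g. g xs) gs) \<le> ack (Suc n) (max_arg xs)" if k: "length xs = k" for xs
  proof -
    have "max_arg (map (\<lambda>g. g xs) gs) \<le> ack n (max_arg xs)"
      unfolding max_arg_le using order_trans[OF M[OF _ k] ack_level_mono[OF n(2)]] by auto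
    then have "ack n (max_arg (map (\<lambda>g. g xs) gs)) \<le> ack n (ack n (max_arg xs))" by (rule ack_monoD)
    moreover have "f (map (\<lambda>g. g xs) gs) \<le> ack n (max_arg (map (\<lambda>g. g xs) gs))"
      using m ack_level_mono[OF n(1)] order_trans by (metis length_map)
    ultimately show ?thesis using ack_twice[of n "max_arg xs"] by linarith
  qed
  then show ?case by blast
next
  case (Rec k f g)
  obtain m1 where m1: "\<And>xs. length xs = k \<Longrightarrow> f xs \<le> ack m1 (max_arg xs)" using Rec.IH by blast
  obtain m2 where m2: "\<And>xs. length xs = Suc (Suc k) \<Longrightarrow> g xs \<le> ack m2 (max_arg xs)" using Rec.IH by blast
  define m where "m = max m1 m2"
  have f: "f xs \<le> ack m (max_arg xs)" if "length xs = k" for xs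
    using m1[OF that] ack_level_mono[of m1 m] unfolding m_def by (meson max.cobounded1 order_trans)
  have g: "g xs \<le> ack m (max_arg xs)" if "length xs = Suc (Suc k)" for xs
    using m2[OF that] ack_level_mono[of m2 m] unfolding m_def by (meson max.cobounded2 order_trans)
  have "rec_nat (f (tl xs)) (\<lambda>m r. g (m # r # tl xs)) (hd xs) \<le> ack (Suc m) (max_arg xs)"
    if "length xs = Suc k" for xs
  proof -
    obtain n ys where xs: "xs = n # ys" and ys: "length ys = k" using \<open>length xs = Suc k\<close> by (cases xs) auto
    define V where "V = max_arg xs"
    have V: "n \<le> V" "max_arg ys \<le> V" using xs by (auto simp: V_def max_arg_def)
    have step: "rec_nat (f ys) (\<lambda>m r. g (m # r # ys)) i \<le> (ack m ^^ Suc i) V" if "i \<le> n" for i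
      using that
    proof (induction i)
      case 0
      then show ?case using f[OF ys] ack_monoD[OF V(2), of m] by simp
    next
      case (Suc i)
      let ?r = "rec_nat (f ys) (\<lambda>m r. g (m # r # ys)) i"
      have infl: "V \<le> (ack m ^^ Suc i) V" using funpow_infl[of "ack m" V "Suc i", OF ack_infl] by linarith
      have ys': "\<forall>y\<in>set ys. y \<le> V" using V(2) by (simp add: max_arg_le)
      have "max_arg (i # ?r # ys) \<le> (ack m ^^ Suc i) V"
        unfolding max_arg_le using Suc V infl ys' by (auto simp del: funpow.simps intro: order_trans)
      then have "ack m (max_arg (i # ?r # ys)) \<le> ack m ((ack m ^^ Suc i) V)" by (rule ack_monoD)
      then show ?case using g[of "i # ?r # ys"] ys by simp
    qed
    have "(ack m ^^ Suc n) V \<le> (ack m ^^ Suc (Suc V)) V"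
      using V by (intro funpow_mono_le[OF ack_mono]) (auto intro: less_imp_le ack_infl)
    then show ?thesis using step[of n] xs unfolding V_def by simp
  qed
  then show ?case by blast
qed

lemma prim_rec1_below_ack:
  assumes "prim_rec1 f" shows "\<exists>m. \<forall>v. f v \<le> ack m v"
proof -
  obtain F where F: "prim_rec 1 F" "\<And>x. F [x] = f x" using assms unfolding prim_rec1_def by blast
  obtain m where "\<And>xs. length xs = 1 \<Longrightarrow> F xs \<le> ack m (max_arg xs)" using prim_rec_below_ack[OF F(1)] by blast
  from this[of "[_]"] show ?thesis by (intro exI[of _ m]) (simp add: F(2) max_arg_def)
qed


lemma prim_rec1_ack: "prim_rec1 (ack k)"
proof (induction k)
  case 0
  show ?case using prim_rec1_Suc by simp
next
  case (Suc k)
  have eq: "ack (Suc k) v = rec_nat v (\<lambda>i r. ack k r) (Suc (Suc v))" for v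
  proof -
    have "(ack k ^^ n) v = rec_nat v (\<lambda>i r. ack k r) n" for n by (induction n) auto
    then show ?thesis by (simp del: funpow.simps)
  qed
  show ?case unfolding prim_rec1_iff eq
    by (intro PR_rec PR_intros PR_app1[OF Suc]) auto
qed

text \<open>
  The relation \<open>ack k b \<le> v\<close> is primitive recursive in all three variables, although \<open>ack\<close> is not a
  primitive recursive function. The reason is that values above \<open>v\<close> need not be known: the truncated
  levels \<open>min (ack k u) w\<close> for \<open>u \<le> w\<close> form a finite table with entries up to \<open>w\<close>. Such a table is coded
  as a number in base \<open>w + 1\<close>, whose \<open>u\<close>-th digit is the entry at \<open>u\<close>.
\<close>

definition digit :: "nat \<Rightarrow> nat \<Rightarrow> nat \<Rightarrow> nat" where
  "digit B c u = c div B ^ u mod B"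

lemma digit_sum:
  assumes "\<And>i. d i < B" and "u < n"
  shows "digit B (\<Sum>i<n. d i * B ^ i) u = d u"
  using assms(2)
proof (induction n)
  case (Suc n)
  have B: "0 < B" using assms(1)[of 0] by linarith
  have small: "(\<Sum>i<n. d i * B ^ i) < B ^ n" for n
  proof (induction n)
    case (Suc n)
    have "d n * B ^ n + B ^ n \<le> B * B ^ n" using assms(1)[of n]
      by (metis Suc_leI add.commute mult_Suc mult_le_mono1)
    then show ?case using Suc by simp
  qed simp
  show ?case
  proof (cases "u = n")
    case True
    have "(\<Sum>i<Suc n. d i * B ^ i) div B ^ n = d n" using small[of n] B by simp
    then show ?thesis using True assms(1) by (simp add: digit_def)
  next
    case False
    then have "u < n" using Suc by simp
    then have "B ^ n = B ^ u * (B * B ^ (n - Suc u))"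
      by (metis Suc_diff_Suc le_add_diff_inverse less_imp_le_nat power_Suc power_add)
    then have "(\<Sum>i<Suc n. d i * B ^ i) div B ^ u
        = ((\<Sum>i<n. d i * B ^ i) + d n * (B * B ^ (n - Suc u)) * B ^ u) div B ^ u"
      by (simp add: ac_simps)
    also have "\<dots> = d n * (B * B ^ (n - Suc u)) + (\<Sum>i<n. d i * B ^ i) div B ^ u"
      using B by (subst div_mult_self1) auto
    also have "\<dots> = (\<Sum>i<n. d i * B ^ i) div B ^ u + B * (d n * B ^ (n - Suc u))"
      by simp
    finally show ?thesis using Suc.IH \<open>u < n\<close> by (simp add: digit_def)
  qed
qed simp

primrec walk :: "nat \<Rightarrow> nat \<Rightarrow> nat \<Rightarrow> nat \<Rightarrow> nat" where
  "walk 0 B c u = u"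
| "walk (Suc n) B c u = digit B c (walk n B c u)"

text \<open>
  The next table comes from the previous one by iterated lookup, since truncation at \<open>w\<close> commutes with
  applying a level: an argument above \<open>w\<close> has a value above \<open>w\<close>.
\<close>

primrec table :: "nat \<Rightarrow> nat \<Rightarrow> nat" where
  "table 0 w = (\<Sum>u<Suc w. min (Suc u) w * Suc w ^ u)"
| "table (Suc k) w = (\<Sum>u<Suc w. walk (Suc (Suc u)) (Suc w) (table k w) u * Suc w ^ u)"

lemma digit_less: "digit (Suc w) c u < Suc w" by (simp add: digit_def)

lemma digit_table: "u \<le> w \<Longrightarrow> digit (Suc w) (table k w) u = min (ack k u) w"
proof (induction k arbitrary: u)
  case 0
  then show ?case unfolding table.simps by (subst digit_sum) auto
next
  case (Suc k)
  have walk: "walk n (Suc w) (table k w) u = min ((ack k ^^ n) u) w" if "u \<le> w" for n u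
  proof (induction n)
    case 0
    then show ?case using that by simp
  next
    case (Suc n)
    have "min (ack k (min x w)) w = min (ack k x) w" for x
    proof (cases "x \<le> w")
      case False
      then have "w \<le> ack k w" "w \<le> ack k x"
        using ack_infl[of w k] ack_infl[of x k] by linarith+
      then show ?thesis using False by simp
    qed simp
    then show ?case using Suc Suc.IH \<open>\<And>u. u \<le> w \<Longrightarrow> digit (Suc w) (table k w) u = min (ack k u) w\<close> by simp
  qed
  have "digit (Suc w) (table (Suc k) w) u = walk (Suc (Suc u)) (Suc w) (table k w) u"
    unfolding table.simps using Suc.prems
    by (subst digit_sum) (auto simp: digit_less simp del: walk.simps(2), simp add: digit_less)
  then show ?case using walk[OF Suc.prems, of "Suc (Suc u)"] by simp
qed

text \<open>
  Truncation at \<open>v + 1\<close> preserves whether a value is at most \<open>v\<close>.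
\<close>

lemma ack_le_iff: "ack k b \<le> v \<longleftrightarrow> b \<le> v \<and> digit (Suc (Suc v)) (table k (Suc v)) b \<le> v"
proof -
  have "b \<le> v" if "ack k b \<le> v" using that ack_infl[of b k] by linarith
  then show ?thesis using digit_table[of b "Suc v" k] by auto
qed

lemma pr3_digit: "pr3 digit"
  unfolding digit_def by (intro PR_intros) auto

lemma pr4_walk: "pr4 walk"
proof -
  have eq: "walk n B c u = rec_nat u (\<lambda>i r. digit B c r) n" for n B c u
    by (induction n) auto
  show ?thesis unfolding eq
    by (intro PR_rec PR_nth PR_app3[OF pr3_digit] PR_nth_drop) auto
qed

lemma pr2_table: "pr2 table"
proof (rule pr2_rec)
  show "table 0 w = (\<Sum>u<Suc w. min (Suc u) w * Suc w ^ u)" for w by simp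
  show "table (Suc k) w = (\<Sum>u<Suc w. walk (Suc (Suc u)) (Suc w) (table k w) u * Suc w ^ u)" for k w by simp
  show "prim_rec1 (\<lambda>w. \<Sum>u<Suc w. min (Suc u) w * Suc w ^ u)"
    unfolding prim_rec1_iff by (intro PR_sum PR_intros) auto
  show "pr3 (\<lambda>k c w. \<Sum>u<Suc w. walk (Suc (Suc u)) (Suc w) c u * Suc w ^ u)"
    by (intro PR_sum PR_mult PR_power PR_app4[OF pr4_walk] PR_Suc PR_nth PR_nth_tl) auto
qed

lemma PRP_ack_le:
  assumes "PR n k" "PR n b" "PR n v"
  shows "PRP n (\<lambda>xs. ack (k xs) (b xs) \<le> v xs)"
  unfolding ack_le_iff
  by (intro PRP_conj PRP_le PR_app3[OF pr3_digit] PR_app2[OF pr2_table] PR_Suc assms)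

section \<open>Rates of growth up to primitive recursive delay\<close>

text \<open>
  A rate plays the role of the function \<open>v \<mapsto>\<close> number of elements up to \<open>v\<close> outside a primitive recursive
  set. Below, \<open>k \<preceq> l\<close> says that \<open>l\<close> catches up with \<open>k\<close> after a primitive recursive delay. The delay may
  always be taken to be monotone and above the identity, which is what \<open>pace\<close> requires.
\<close>

definition rate :: "(nat \<Rightarrow> nat) \<Rightarrow> bool" where
  "rate k \<longleftrightarrow> prim_rec1 k \<and> mono k \<and> (\<forall>n. \<exists>v. n \<le> k v)"

definition rle :: "(nat \<Rightarrow> nat) \<Rightarrow> (nat \<Rightarrow> nat) \<Rightarrow> bool" (infix "\<preceq>" 50) where
  "k \<preceq> l \<longleftrightarrow> (\<exists>g. prim_rec1 g \<and> (\<forall>v. k v \<le> l (g v)))"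

definition pace :: "(nat \<Rightarrow> nat) \<Rightarrow> bool" where
  "pace g \<longleftrightarrow> prim_rec1 g \<and> mono g \<and> (\<forall>v. v \<le> g v)"

definition cone :: "(nat \<Rightarrow> nat) \<Rightarrow> (nat \<Rightarrow> nat) set" where
  "cone k = {a. rate a \<and> a \<preceq> k}"

lemma rate_prim_rec1: "rate k \<Longrightarrow> prim_rec1 k" and rate_mono: "rate k \<Longrightarrow> mono k"
  by (auto simp: rate_def)

lemma rate_monoD: "rate k \<Longrightarrow> u \<le> v \<Longrightarrow> k u \<le> k v"
  by (auto simp: rate_def dest: monoD)

lemma rate_unbounded: "rate k \<Longrightarrow> \<exists>v\<ge>N. n \<le> k v"
  using rate_monoD[of k] unfolding rate_def by (meson linear order_trans)

lemma paceD: "pace g \<Longrightarrow> prim_rec1 g" "pace g \<Longrightarrow> u \<le> v \<Longrightarrow> g u \<le> g v" "pace g \<Longrightarrow> v \<le> g v"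
  by (auto simp: pace_def dest: monoD)

lemma pace_majorant:
  assumes "prim_rec1 g" obtains h where "pace h" "\<And>v. g v \<le> h v"
proof
  let ?h = "\<lambda>v. v + (\<Sum>i<Suc v. g i)"
  have "prim_rec1 ?h"
    unfolding prim_rec1_iff by (intro PR_intros PR_sum PR_app1[OF assms]) auto
  moreover have "mono ?h" by (intro monoI add_mono sum_mono2) auto
  ultimately show "pace ?h" by (simp add: pace_def)
  show "g v \<le> ?h v" for v by simp
qed

lemma pace_comp:
  assumes "pace g" "pace h" shows "pace (\<lambda>v. g (h v))"
  unfolding pace_def
proof (intro conjI allI monoI)
  show "prim_rec1 (\<lambda>v. g (h v))" by (rule prim_rec1_comp[OF paceD(1)[OF assms(2)] paceD(1)[OF assms(1)]])
  show "g (h u) \<le> g (h v)" if "u \<le> v" for u v using that assms by (simp add: paceD)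
  show "v \<le> g (h v)" for v using paceD(3)[OF assms(2), of v] paceD(3)[OF assms(1), of "h v"] by simp
qed

lemma pace_id: "pace (\<lambda>v. v)"
  unfolding pace_def prim_rec1_iff by (simp add: PR_nth mono_def)

lemma pace_max:
  assumes "pace g" "pace h" shows "pace (\<lambda>v. max (g v) (h v))"
  unfolding pace_def
proof (intro conjI allI monoI)
  show "prim_rec1 (\<lambda>v. max (g v) (h v))"
    unfolding prim_rec1_iff
    by (intro PR_max PR_app1[OF paceD(1)[OF assms(1)]] PR_app1[OF paceD(1)[OF assms(2)]] PR_nth) auto
  show "max (g u) (h u) \<le> max (g v) (h v)" if "u \<le> v" for u v
    using that assms by (intro max.mono) (auto simp: paceD)
  show "v \<le> max (g v) (h v)" for v using paceD(3)[OF assms(1), of v] by simp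
qed

lemma pace_ack: "pace (ack k)"
  by (auto simp: pace_def prim_rec1_ack ack_mono less_imp_le ack_infl)

lemma rleE:
  assumes "k \<preceq> l" "mono l" obtains g where "pace g" "\<And>v. k v \<le> l (g v)"
proof -
  obtain g where g: "prim_rec1 g" "\<And>v. k v \<le> l (g v)" using assms unfolding rle_def by blast
  obtain h where "pace h" "\<And>v. g v \<le> h v" using pace_majorant[OF g(1)] by blast
  then show ?thesis using g(2) assms(2) that by (meson monoD order_trans)
qed

lemma rleI: "pace g \<Longrightarrow> (\<And>v. k v \<le> l (g v)) \<Longrightarrow> k \<preceq> l"
  unfolding rle_def pace_def by blast

lemma rle_pointwise: "(\<And>v. k v \<le> l v) \<Longrightarrow> k \<preceq> l"
  by (rule rleI[OF pace_id])

lemma rle_refl: "k \<preceq> k" by (simp add: rle_pointwise)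

lemma rle_trans:
  assumes "k \<preceq> l" "l \<preceq> m" shows "k \<preceq> m"
proof -
  obtain g where g: "prim_rec1 g" "\<And>v. k v \<le> l (g v)" using assms(1) unfolding rle_def by blast
  obtain h where h: "prim_rec1 h" "\<And>v. l v \<le> m (h v)" using assms(2) unfolding rle_def by blast
  have "k v \<le> m (h (g v))" for v using g(2)[of v] h(2)[of "g v"] by simp
  then show ?thesis unfolding rle_def using prim_rec1_comp[OF g(1) h(1)] by blast
qed

text \<open>
  Finitely many arguments do not matter, because a constant can be added to the delay.
\<close>

lemma rle_eventually:
  assumes "rate k" "rate l" "pace g" "\<And>v. N \<le> v \<Longrightarrow> k v \<le> l (g v)"
  shows "k \<preceq> l"
proof -
  obtain M where M: "k N \<le> l M" using assms(2) unfolding rate_def by blast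
  have "prim_rec1 (\<lambda>v. g v + M)"
    unfolding prim_rec1_iff by (intro PR_intros PR_app1[OF paceD(1)[OF assms(3)]]) auto
  moreover have "k v \<le> l (g v + M)" for v
  proof (cases "N \<le> v")
    case True
    then show ?thesis using assms(4)[OF True] rate_monoD[OF assms(2), of "g v" "g v + M"] by simp
  next
    case False
    then show ?thesis using M rate_monoD[OF assms(1), of v N] rate_monoD[OF assms(2), of M "g v + M"] by simp
  qed
  ultimately show ?thesis unfolding rle_def by blast
qed

lemma not_rle_eventually:
  assumes "rate k" "rate l" "\<not> k \<preceq> l" "pace g"
  shows "\<exists>v\<ge>N. l (g v) < k v"
  using rle_eventually[OF assms(1,2,4), of N] assms(3) not_le by blast

lemma rate_max_mono:
  assumes "rate k" "prim_rec1 l" "mono l" shows "rate (\<lambda>v. max (k v) (l v))"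
  unfolding rate_def
proof (intro conjI allI monoI)
  show "prim_rec1 (\<lambda>v. max (k v) (l v))"
    using assms unfolding rate_def prim_rec1_iff by (simp add: PR_max)
  show "max (k u) (l u) \<le> max (k v) (l v)" if "u \<le> v" for u v
    using that assms by (intro max.mono) (auto simp: rate_monoD monoD)
  show "\<exists>v. n \<le> max (k v) (l v)" for n using assms unfolding rate_def by (simp add: le_max_iff_disj) blast
qed

lemma rate_max: "rate k \<Longrightarrow> rate l \<Longrightarrow> rate (\<lambda>v. max (k v) (l v))"
  by (intro rate_max_mono rate_prim_rec1 rate_mono)

lemma rate_min:
  assumes "rate k" "rate l" shows "rate (\<lambda>v. min (k v) (l v))"
  unfolding rate_def
proof (intro conjI allI monoI)
  show "prim_rec1 (\<lambda>v. min (k v) (l v))"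
    using assms unfolding rate_def prim_rec1_iff by (simp add: PR_min)
  show "min (k u) (l u) \<le> min (k v) (l v)" if "u \<le> v" for u v
    using that assms by (intro min.mono) (auto simp: rate_monoD)
  show "\<exists>v. n \<le> min (k v) (l v)" for n
  proof -
    obtain v where "n \<le> k v" using assms unfolding rate_def by blast
    moreover obtain w where "w \<ge> v" "n \<le> l w" using rate_unbounded[OF assms(2)] by blast
    ultimately have "n \<le> min (k w) (l w)" using rate_monoD[OF assms(1), of v w] by simp
    then show ?thesis by blast
  qed
qed

lemma rate_le_delay: "rate k \<Longrightarrow> pace g \<Longrightarrow> k v \<le> k (g v)"
  by (simp add: paceD rate_monoD)

lemma rate_delay:
  assumes "rate k" "pace g" 
  shows "rate (\<lambda>v. k (g v))"
  unfolding rate_def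
proof (intro conjI allI monoI)
  show "prim_rec1 (\<lambda>v. k (g v))"
    by (rule prim_rec1_comp[OF paceD(1)[OF assms(2)] rate_prim_rec1[OF assms(1)]])
  show "k (g u) \<le> k (g v)" if "u \<le> v" for u v
    using that assms by (simp add: paceD rate_monoD)
  show "\<exists>v. n \<le> k (g v)" for n
    using assms(1) rate_le_delay[OF assms] unfolding rate_def by (meson order_trans)
qed

lemma PR_delay: "rate k \<Longrightarrow> pace g \<Longrightarrow> PR 1 (\<lambda>xs. k (g (xs ! 0)))"
  using rate_prim_rec1[OF rate_delay] by (simp add: prim_rec1_iff)

text \<open>
  By this and the following lemma, pointwise maximum and minimum are suprema and infima for \<open>\<preceq>\<close>: two
  delays are replaced by their maximum.
\<close>

lemma max_rle: "a \<preceq> e \<Longrightarrow> b \<preceq> e \<Longrightarrow> mono e \<Longrightarrow> (\<lambda>v. max (a v) (b v)) \<preceq> e"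
proof -
  assume a: "a \<preceq> e" "b \<preceq> e" "mono e"
  obtain g h where gh: "pace g" "\<And>v. a v \<le> e (g v)" "pace h" "\<And>v. b v \<le> e (h v)"
    using rleE[OF a(1) a(3)] rleE[OF a(2) a(3)] by metis
  have "max (a v) (b v) \<le> e (max (g v) (h v))" for v
    using gh(2)[of v] gh(4)[of v] monoD[OF a(3), of "g v" "max (g v) (h v)"]
      monoD[OF a(3), of "h v" "max (g v) (h v)"] by simp
  then show ?thesis by (rule rleI[OF pace_max[OF gh(1,3)]])
qed

lemma rle_min: "m \<preceq> a \<Longrightarrow> m \<preceq> b \<Longrightarrow> mono a \<Longrightarrow> mono b \<Longrightarrow> m \<preceq> (\<lambda>v. min (a v) (b v))"
proof -
  assume a: "m \<preceq> a" "m \<preceq> b" "mono a" "mono b"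
  obtain g h where gh: "pace g" "\<And>v. m v \<le> a (g v)" "pace h" "\<And>v. m v \<le> b (h v)"
    using rleE[OF a(1) a(3)] rleE[OF a(2) a(4)] by metis
  have "m v \<le> min (a (max (g v) (h v))) (b (max (g v) (h v)))" for v
    using gh(2)[of v] gh(4)[of v] monoD[OF a(3), of "g v" "max (g v) (h v)"]
      monoD[OF a(4), of "h v" "max (g v) (h v)"] by simp
  then show ?thesis by (rule rleI[OF pace_max[OF gh(1,3)]])
qed

section \<open>Lower cones as cones of rates\<close>

text \<open>
  The number of elements of the complement of \<open>Z\<close> up to \<open>v\<close>, see \<open>cnt_card\<close>.
\<close>

primrec cnt :: "nat set \<Rightarrow> nat \<Rightarrow> nat" where
  "cnt Z 0 = (if 0 \<in> Z then 0 else 1)"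
| "cnt Z (Suc v) = (if Suc v \<in> Z then cnt Z v else Suc (cnt Z v))"

lemma cnt_card: "cnt Z v = card {z. z \<le> v \<and> z \<notin> Z}"
proof (induction v)
  case 0
  have "{z. z \<le> (0::nat) \<and> z \<notin> Z} = (if 0 \<in> Z then {} else {0})" by (auto intro: gr0I)
  then show ?case by simp
next
  case (Suc v)
  have "{z. z \<le> Suc v \<and> z \<notin> Z} = (if Suc v \<in> Z then {z. z \<le> v \<and> z \<notin> Z}
      else insert (Suc v) {z. z \<le> v \<and> z \<notin> Z})" by (auto simp: le_Suc_eq)
  then show ?case using Suc by simp
qed

lemma cnt_mono: "mono (cnt Z)"
  by (rule mono_iff_le_Suc[THEN iffD2]) auto

lemma cnt_le: "u \<le> v \<Longrightarrow> cnt Z u \<le> cnt Z v" using cnt_mono by (rule monoD)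

lemma cnt_less: "u < v \<Longrightarrow> v \<notin> Z \<Longrightarrow> cnt Z u < cnt Z v"
  using cnt_le[of u "v - 1" Z] by (cases v) auto

lemma cnt_inj: "u \<notin> Z \<Longrightarrow> v \<notin> Z \<Longrightarrow> cnt Z u = cnt Z v \<Longrightarrow> u = v"
  using cnt_less[of u v Z] cnt_less[of v u Z] by (metis less_irrefl linorder_neqE_nat)

lemma cnt_pos: "v \<notin> Z \<Longrightarrow> 0 < cnt Z v" by (cases v) auto

lemma prim_rec1_cnt: "prim_rec_set Z \<Longrightarrow> prim_rec1 (cnt Z)"
  by (rule prim_rec1_rec[of _ _ "\<lambda>v r. if Suc v \<in> Z then r else Suc r"])
    (auto intro!: PR_if PRP_in PR_Suc PR_nth)

lemma rate_cnt:
  assumes "prim_rec_set Z" "infinite (- Z)" shows "rate (cnt Z)"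
proof -
  have "\<exists>v. n \<le> cnt Z v" for n
  proof (induction n)
    case (Suc n)
    then obtain v where v: "n \<le> cnt Z v" by blast
    obtain w where "w \<in> - Z" "v < w" using assms(2) infinite_nat_iff_unbounded by blast
    then show ?case using v cnt_less[of v w Z] by (intro exI[of _ w]) simp
  qed simp
  then show ?thesis using assms by (simp add: rate_def prim_rec1_cnt cnt_mono)
qed

text \<open>
  For a monotone function, the first argument reaching a value is the number of arguments that do not
  reach it, so it is primitive recursive as soon as a bound is known.
\<close>

lemma first_reach:
  fixes f :: "nat \<Rightarrow> nat"
  assumes f: "mono f" and n: "n \<le> f v"
  defines "y \<equiv> \<Sum>i<Suc v. if f i < n then 1 else (0::nat)"
  shows "y = (LEAST i. n \<le> f i)"
proof -
  define y' where "y' = (LEAST i. n \<le> f i)"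
  have y': "n \<le> f y'" "y' \<le> v" using n unfolding y'_def by (auto intro: LeastI Least_le)
  have less: "i < y' \<longleftrightarrow> f i < n" for i
  proof
    show "f i < n" if "i < y'" using not_less_Least[OF that[unfolded y'_def]] by simp
    show "i < y'" if "f i < n" using that y'(1) monoD[OF f, of y' i] by (meson leD leI order_trans)
  qed
  have "y = card {i. i < Suc v \<and> f i < n}"
    unfolding y_def by (simp add: sum.If_cases Int_def del: sum.lessThan_Suc)
  also have "{i. i < Suc v \<and> f i < n} = {..<y'}" unfolding less[symmetric] using y'(2) by auto
  finally show ?thesis by (simp add: y'_def)
qed

lemma first_count:
  assumes n: "0 < n" "n \<le> cnt W v"
  defines "y \<equiv> \<Sum>i<Suc v. if cnt W i < n then 1 else (0::nat)"
  shows "y \<notin> W \<and> cnt W y = n"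
proof -
  have y: "y = (LEAST i. n \<le> cnt W i)" unfolding y_def by (rule first_reach[OF cnt_mono n(2)])
  have reach: "n \<le> cnt W y" unfolding y using n(2) by (rule LeastI)
  have before: "cnt W i < n" if "i < y" for i
    using not_less_Least[OF that[unfolded y]] by simp
  show ?thesis
  proof (cases y)
    case 0
    then show ?thesis using reach n(1) by (auto split: if_splits)
  next
    case (Suc u)
    then show ?thesis using before[of u] reach by (auto split: if_splits)
  qed
qed

text \<open>
  The reduction sends the \<open>n\<close>-th element of the complement of \<open>Z\<close> to the \<open>n\<close>-th element of the
  complement of \<open>W\<close>. The delay between the counting functions bounds the search for it.
\<close>

lemma R_of_le_if_cnt_le:
  assumes Z: "prim_rec_set Z" and W: "prim_rec_set W" and le: "cnt Z \<preceq> cnt W"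
  shows "R_of Z \<le>pr R_of W"
proof (cases "W = {}")
  case True
  let ?f = "\<lambda>x. if x \<in> Z then 0 else cnt Z x"
  have "prim_rec1 ?f"
    unfolding prim_rec1_iff by (intro PR_intros Z PR_app1[OF prim_rec1_cnt[OF Z]]) auto
  moreover have "(x, y) \<in> R_of Z \<longleftrightarrow> (?f x, ?f y) \<in> R_of W" for x y
    using cnt_inj[of x Z y] cnt_pos[of x Z] cnt_pos[of y Z] True by (auto simp: R_of_def)
  ultimately show ?thesis unfolding pr_le_def by blast
next
  case False
  then obtain w where w: "w \<in> W" by blast
  obtain g where g: "pace g" "\<And>v. cnt Z v \<le> cnt W (g v)" using rleE[OF le cnt_mono] by blast
  \<comment> \<open>the element outside \<open>W\<close> with the same index as \<open>x\<close>, see \<open>first_count\<close>\<close>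
  let ?p = "\<lambda>x. \<Sum>i<Suc (g x). if cnt W i < cnt Z x then 1 else (0::nat)"
  let ?f = "\<lambda>x. if x \<in> Z then w else ?p x"
  have "prim_rec1 ?f"
    unfolding prim_rec1_iff
    by (intro PR_if PR_sum PR_Suc PR_const PR_nth PR_nth_tl PRP_in PRP_less PR_app1[OF paceD(1)[OF g(1)]]
        PR_app1[OF prim_rec1_cnt[OF Z]] PR_app1[OF prim_rec1_cnt[OF W]] Z) auto
  moreover have p: "?p x \<notin> W \<and> cnt W (?p x) = cnt Z x" if "x \<notin> Z" for x
    by (rule first_count) (use that g(2) cnt_pos in auto)
  have "(x, y) \<in> R_of Z \<longleftrightarrow> (?f x, ?f y) \<in> R_of W" for x y
  proof -
    have "x = y" if "x \<notin> Z" "y \<notin> Z" "?p x = ?p y"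
      using p[OF that(1)] p[OF that(2)] that cnt_inj[of x Z y] by metis
    then show ?thesis using p[of x] p[of y] w by (cases "x \<in> Z"; cases "y \<in> Z") (auto simp: R_of_def)
  qed
  ultimately show ?thesis unfolding pr_le_def by blast
qed

text \<open>
  The elements up to \<open>v\<close> outside \<open>Z\<close> and one further element are pairwise inequivalent, so a reduction
  sends them to inequivalent elements. At most one image lies in \<open>W\<close>, hence at least as many elements of
  the complement of \<open>W\<close> lie below any bound on the images.
\<close>

lemma cnt_le_if_R_of_le:
  assumes "R_of Z \<le>pr R_of W"
  shows "cnt Z \<preceq> cnt W"
proof -
  obtain f where f: "prim_rec1 f" "\<And>x y. (x, y) \<in> R_of Z \<longleftrightarrow> (f x, f y) \<in> R_of W"
    using assms unfolding pr_le_def by blast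
  define z where "z = (SOME z. z \<in> Z)"
  \<comment> \<open>the further element: a member of \<open>Z\<close> if there is one, and otherwise
    the first number that is not yet counted\<close>
  define e where "e v = (if Z = {} then Suc v else z)" for v
  have e: "e v \<in> Z \<or> (Z = {} \<and> e v = Suc v)" for v
    unfolding e_def z_def by (auto intro: someI)
  let ?g = "\<lambda>v. \<Sum>i<v + z + 2. f i"
  have "prim_rec1 ?g"
    unfolding prim_rec1_iff by (intro PR_sum PR_intros PR_app1[OF f(1)]) auto
  moreover have "cnt Z v \<le> cnt W (?g v)" for v
  proof -
    let ?N = "{x. x \<le> v \<and> x \<notin> Z}"
    let ?D = "insert (e v) ?N"
    have e': "e v \<notin> ?N" using e[of v] by auto
    have unrel: "x = y" if "x \<in> ?D" "y \<in> ?D" "(x, y) \<in> R_of Z" for x y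
      using that e[of v] by (auto simp: R_of_def)
    have unrel': "x = y" if "x \<in> ?D" "y \<in> ?D" "(f x, f y) \<in> R_of W" for x y
      using unrel[OF that(1,2)] f(2) that(3) by blast
    have inj: "inj_on f ?D" by (rule inj_onI, rule unrel') (auto simp: R_of_def)
    have fin: "finite (f ` ?D)" by simp
    have "card (f ` ?D \<inter> W) \<le> 1"
    proof -
      have "\<forall>a\<in>f ` ?D \<inter> W. \<forall>b\<in>f ` ?D \<inter> W. a = b"
      proof clarify
        fix x y assume "f x \<in> W" "f y \<in> W" "x \<in> ?D" "y \<in> ?D"
        then show "f x = f y" using unrel'[of x y] by (simp add: R_of_def)
      qed
      then have "card (f ` ?D \<inter> W) \<le> Suc 0"
        by (rule card_le_Suc0_iff_eq[OF finite_Int[OF disjI1[OF fin]], THEN iffD2])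
      then show ?thesis by (simp only: One_nat_def)
    qed
    moreover have "card (f ` ?D) = Suc (cnt Z v)"
      using card_image[OF inj] e' by (simp add: cnt_card)
    moreover have "card (f ` ?D) = card (f ` ?D - W) + card (f ` ?D \<inter> W)"
      by (rule trans[OF card_Int_Diff[OF fin, of W] add.commute])
    moreover have "card (f ` ?D - W) \<le> cnt W (?g v)"
      unfolding cnt_card
    proof (rule card_mono)
      show "f ` ?D - W \<subseteq> {y. y \<le> ?g v \<and> y \<notin> W}"
      proof clarify
        fix x assume x: "x \<in> ?D"
        have "e v \<le> v + z + 1" by (simp add: e_def)
        then have "x < v + z + 2" using x by auto
        then show "f x \<le> ?g v" by (intro member_le_sum) auto
      qed
    qed simp
    ultimately show ?thesis by linarith
  qed
  ultimately show ?thesis unfolding rle_def by blast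
qed

lemma R_of_le_iff:
  "prim_rec_set Z \<Longrightarrow> prim_rec_set W \<Longrightarrow> R_of Z \<le>pr R_of W \<longleftrightarrow> cnt Z \<preceq> cnt W"
  using R_of_le_if_cnt_le cnt_le_if_R_of_le by blast

lemma punctual_R_of:
  assumes "prim_rec_set Z" shows "punctual (R_of Z) \<longleftrightarrow> infinite (- Z)"
proof -
  have eq: "equiv UNIV (R_of Z)"
    by (auto simp: equiv_def R_of_def refl_on_def sym_on_def trans_def)
  have "PR 2 (\<lambda>xs. if (xs ! 0 \<in> Z \<and> xs ! Suc 0 \<in> Z) \<or> xs ! 0 = xs ! Suc 0 then 1 else 0)"
    by (intro PR_if PRP_disj PRP_conj PRP_in PRP_eq PR_nth PR_const assms) auto
  then obtain F where F: "prim_rec 2 F" "\<And>xs. length xs = 2 \<Longrightarrow>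
      F xs = (if (xs ! 0 \<in> Z \<and> xs ! Suc 0 \<in> Z) \<or> xs ! 0 = xs ! Suc 0 then 1 else 0)"
    unfolding PR_def by blast
  have rel: "prim_rec_rel (R_of Z)"
    unfolding prim_rec_rel_def R_of_def using F(1) F(2)[of "[_, _]"] by (intro exI[of _ F]) auto
  have sub: "UNIV // R_of Z \<subseteq> insert Z ((\<lambda>x. {x}) ` (- Z))"
    by (auto simp: quotient_def R_of_def)
  have sup: "(\<lambda>x. {x}) ` (- Z) \<subseteq> UNIV // R_of Z"
    by (auto simp: quotient_def R_of_def)
  have "finite (UNIV // R_of Z) \<longleftrightarrow> finite (- Z)"
  proof
    assume "finite (UNIV // R_of Z)"
    from finite_subset[OF sup this] show "finite (- Z)" by (rule finite_imageD) (simp add: inj_on_def)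
  next
    assume "finite (- Z)"
    then have "finite (insert Z ((\<lambda>x. {x}) ` (- Z)))" by blast
    from finite_subset[OF sub this] show "finite (UNIV // R_of Z)" .
  qed
  then show ?thesis using eq rel by (simp add: punctual_def)
qed

primrec step_cnt :: "(nat \<Rightarrow> nat) \<Rightarrow> nat \<Rightarrow> nat" where
  "step_cnt k 0 = 0"
| "step_cnt k (Suc v) = (if step_cnt k v < k (Suc v) then Suc (step_cnt k v) else step_cnt k v)"

text \<open>
  Not every rate is a counting function, since those grow by at most one in each step. The function
  \<open>step_cnt k\<close> grows as fast as this allows while staying below \<open>k\<close>, and lags behind \<open>k\<close> only by the delay
  \<open>v \<mapsto> v + k v\<close>.
\<close>

definition set_of_rate :: "(nat \<Rightarrow> nat) \<Rightarrow> nat set" where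
  "set_of_rate k = - {Suc v |v. step_cnt k v < k (Suc v)}"

lemma cnt_set_of_rate: "cnt (set_of_rate k) v = step_cnt k v"
  by (induction v) (auto simp: set_of_rate_def)

lemma prim_rec_set_set_of_rate: assumes "prim_rec1 k" shows "prim_rec_set (set_of_rate k)"
proof -
  have s: "prim_rec1 (step_cnt k)"
    by (rule prim_rec1_rec[of _ _ "\<lambda>v r. if r < k (Suc v) then Suc r else r"])
      (auto intro!: PR_if PRP_less PR_Suc PR_nth PR_app1[OF assms])
  have "x \<in> set_of_rate k \<longleftrightarrow> \<not> (0 < x \<and> step_cnt k (x - 1) < k x)" for x
    by (cases x) (auto simp: set_of_rate_def)
  then show ?thesis
    unfolding prim_rec_set_def prim_rec1_iff
    by simp (intro PR_if PRP_disj PRP_conj PRP_not PRP_less PRP_eq PR_diff PR_const PR_nth PR_app1[OF s] PR_app1[OF assms]; simp)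
qed

lemma step_cnt_le: "mono k \<Longrightarrow> step_cnt k v \<le> k v"
proof (induction v)
  case (Suc v)
  then show ?case using monoD[of k v "Suc v"] by auto
qed simp

lemma step_cnt_catch_up: "mono k \<Longrightarrow> min (k v) j \<le> step_cnt k (v + j)"
proof (induction j)
  case (Suc j)
  have "k v \<le> k (Suc (v + j))" using Suc.prems by (simp add: monoD)
  then show ?case using Suc by (auto simp: min_def split: if_splits)
qed simp

lemma cnt_set_of_rate_equiv:
  assumes "rate k" shows "cnt (set_of_rate k) \<preceq> k" "k \<preceq> cnt (set_of_rate k)"
proof -
  show "cnt (set_of_rate k) \<preceq> k"
    using step_cnt_le[OF rate_mono[OF assms]] by (auto simp: cnt_set_of_rate intro: rle_pointwise)
  have "prim_rec1 (\<lambda>v. v + k v)"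
    unfolding prim_rec1_iff by (intro PR_intros PR_app1[OF rate_prim_rec1[OF assms]]) auto
  moreover have "k v \<le> cnt (set_of_rate k) (v + k v)" for v
    using step_cnt_catch_up[OF rate_mono[OF assms], of v "k v"] by (simp add: cnt_set_of_rate)
  ultimately show "k \<preceq> cnt (set_of_rate k)" unfolding rle_def by blast
qed

lemma infinite_set_of_rate: assumes "rate k" shows "infinite (- set_of_rate k)"
proof
  assume fin: "finite (- set_of_rate k)"
  obtain g where g: "\<And>v. k v \<le> cnt (set_of_rate k) (g v)" using cnt_set_of_rate_equiv(2)[OF assms] unfolding rle_def by blast
  have "cnt (set_of_rate k) v \<le> card (- set_of_rate k)" for v
    unfolding cnt_card by (rule card_mono[OF fin]) auto
  moreover obtain v where "Suc (card (- set_of_rate k)) \<le> k v" using assms unfolding rate_def by blast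
  ultimately show False using g[of v] by (meson not_less_eq_eq order_trans)
qed

lemma deg_eq_iff:
  assumes "punctual R" "punctual S" shows "deg R = deg S \<longleftrightarrow> R \<le>pr S \<and> S \<le>pr R"
  unfolding deg_def using eq_equiv_class_iff[OF equiv_pr_equiv, of R S] assms by (auto simp: pr_equiv_def)

text \<open>
  By this lemma and the next one, \<open>k \<mapsto> deg (R_of (set_of_rate k))\<close> maps the rates below \<open>cnt X\<close> onto the
  lower cone of \<open>X\<close> and preserves and reflects the order. It need not be injective, so \<open>cone (cnt X)\<close> is
  only a preorder.
\<close>

lemma lowercone_eq_image:
  assumes X: "prim_rec_set X"
  shows "lowercone X = (\<lambda>k. deg (R_of (set_of_rate k))) ` cone (cnt X)"
proof (intro equalityI subsetI)
  fix d assume "d \<in> lowercone X"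
  then obtain Z where Z: "d = deg (R_of Z)" "prim_rec_set Z" "punctual (R_of Z)" "R_of Z \<le>pr R_of X"
    unfolding lowercone_def by blast
  then have inf: "infinite (- Z)" by (simp add: punctual_R_of)
  have rate: "rate (cnt Z)" by (rule rate_cnt[OF Z(2) inf])
  have "cnt Z \<in> cone (cnt X)" using rate Z(4) by (simp add: cone_def cnt_le_if_R_of_le)
  moreover have "d = deg (R_of (set_of_rate (cnt Z)))"
    unfolding Z(1)
    using cnt_set_of_rate_equiv[OF rate] infinite_set_of_rate[OF rate] prim_rec_set_set_of_rate[OF rate_prim_rec1[OF rate]] Z(2,3)
    by (subst deg_eq_iff) (auto simp: R_of_le_iff punctual_R_of)
  ultimately show "d \<in> (\<lambda>k. deg (R_of (set_of_rate k))) ` cone (cnt X)" by blast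
next
  fix d assume "d \<in> (\<lambda>k. deg (R_of (set_of_rate k))) ` cone (cnt X)"
  then obtain k where k: "rate k" "k \<preceq> cnt X" "d = deg (R_of (set_of_rate k))" unfolding cone_def by blast
  have "cnt (set_of_rate k) \<preceq> cnt X" using cnt_set_of_rate_equiv(1)[OF k(1)] k(2) by (rule rle_trans)
  then show "d \<in> lowercone X"
    unfolding lowercone_def k(3)
    using prim_rec_set_set_of_rate[OF rate_prim_rec1[OF k(1)]] infinite_set_of_rate[OF k(1)] X
    by (auto simp: R_of_le_iff punctual_R_of)
qed

lemma deg_le_set_of_rate_iff:
  assumes "rate k" "rate l"
  shows "deg_le (deg (R_of (set_of_rate k))) (deg (R_of (set_of_rate l))) \<longleftrightarrow> k \<preceq> l"
proof -
  have p: "prim_rec_set (set_of_rate k)" "prim_rec_set (set_of_rate l)" using assms by (auto intro: prim_rec_set_set_of_rate rate_prim_rec1)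
  have "deg_le (deg (R_of (set_of_rate k))) (deg (R_of (set_of_rate l))) \<longleftrightarrow> cnt (set_of_rate k) \<preceq> cnt (set_of_rate l)"
    using p infinite_set_of_rate assms by (subst deg_le_deg_iff) (auto simp: punctual_R_of R_of_le_iff)
  also have "\<dots> \<longleftrightarrow> k \<preceq> l"
    using cnt_set_of_rate_equiv[OF assms(1)] cnt_set_of_rate_equiv[OF assms(2)] rle_trans by blast
  finally show ?thesis .
qed

section \<open>An order-theoretic invariant\<close>

text \<open>
  The notions of this section are phrased for a preorder \<open>le\<close> on a carrier \<open>P\<close> without mentioning
  suprema and infima, so that they make sense in \<open>cone k\<close> as well as in the lower cone, and
  transfer between them. With lattice operations, \<open>le_sup c a b\<close> reads \<open>c \<le> a \<squnion> b\<close> and \<open>inf_le a b e\<close>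
  reads \<open>a \<sqinter> b \<le> e\<close>.
\<close>

definition is_top :: "'a set \<Rightarrow> ('a \<Rightarrow> 'a \<Rightarrow> bool) \<Rightarrow> 'a \<Rightarrow> bool" where
  "is_top P le a \<longleftrightarrow> (\<forall>d\<in>P. le d a)"

definition le_sup :: "'a set \<Rightarrow> ('a \<Rightarrow> 'a \<Rightarrow> bool) \<Rightarrow> 'a \<Rightarrow> 'a \<Rightarrow> 'a \<Rightarrow> bool" where
  "le_sup P le c a b \<longleftrightarrow> (\<forall>e\<in>P. le a e \<and> le b e \<longrightarrow> le c e)"

definition inf_le :: "'a set \<Rightarrow> ('a \<Rightarrow> 'a \<Rightarrow> bool) \<Rightarrow> 'a \<Rightarrow> 'a \<Rightarrow> 'a \<Rightarrow> bool" where
  "inf_le P le a b e \<longleftrightarrow> (\<forall>m\<in>P. le m a \<and> le m b \<longrightarrow> le m e)"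

definition covers :: "'a set \<Rightarrow> ('a \<Rightarrow> 'a \<Rightarrow> bool) \<Rightarrow> 'a \<Rightarrow> 'a \<Rightarrow> bool" where
  "covers P le a b \<longleftrightarrow> (\<forall>d\<in>P. le_sup P le d a b)"

text \<open>
  The infimum of \<open>a\<close> and \<open>b\<close> is superfluous: whatever it completes to the top is itself the top. In this
  form the condition on \<open>e\<close> says that the supremum of \<open>a \<sqinter> b\<close> and \<open>c\<close> is the top.
\<close>

definition small_inf :: "'a set \<Rightarrow> ('a \<Rightarrow> 'a \<Rightarrow> bool) \<Rightarrow> 'a \<Rightarrow> 'a \<Rightarrow> bool" where
  "small_inf P le a b \<longleftrightarrow>
    (\<forall>c\<in>P. (\<forall>e\<in>P. inf_le P le a b e \<and> le c e \<longrightarrow> is_top P le e) \<longrightarrow> is_top P le c)"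

text \<open>
  The dual pseudocomplement of an element \<open>c\<close> other than the top.
\<close>

definition regular :: "'a set \<Rightarrow> ('a \<Rightarrow> 'a \<Rightarrow> bool) \<Rightarrow> 'a \<Rightarrow> bool" where
  "regular P le u \<longleftrightarrow>
    (\<exists>c\<in>P. \<not> is_top P le c \<and> covers P le u c \<and> (\<forall>v\<in>P. covers P le v c \<longrightarrow> le u v))"

text \<open>
  In lattice terms, any two elements \<open>c\<close>, \<open>d\<close> below \<open>f\<close> have differences \<open>c - d \<le> c'\<close> and \<open>d - c \<le> d'\<close> with
  \<open>c' \<sqinter> d' \<le> u\<close>. So, modulo \<open>u\<close>, the part of \<open>c\<close> exceeding \<open>d\<close> and the part of \<open>d\<close> exceeding \<open>c\<close> can be
  separated. This is a way of saying that the step from \<open>u\<close> to \<open>f\<close> is a small one.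
\<close>

definition narrow :: "'a set \<Rightarrow> ('a \<Rightarrow> 'a \<Rightarrow> bool) \<Rightarrow> 'a \<Rightarrow> 'a \<Rightarrow> bool" where
  "narrow P le u f \<longleftrightarrow>
    (\<forall>c\<in>P. \<forall>d\<in>P. le c f \<and> le d f \<longrightarrow>
      (\<exists>c'\<in>P. \<exists>d'\<in>P. le_sup P le c d c' \<and> le_sup P le d c d' \<and> inf_le P le c' d' u))"

text \<open>
  Whenever the top is the supremum of two smaller elements \<open>a\<close> and \<open>b\<close> whose infimum is superfluous, a small
  step leads from some regular element below \<open>a\<close> to an element that is not below \<open>a\<close>. As the premises are
  symmetric, the same then holds for \<open>b\<close>.
\<close>

definition splits :: "'a set \<Rightarrow> ('a \<Rightarrow> 'a \<Rightarrow> bool) \<Rightarrow> bool" where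
  "splits P le \<longleftrightarrow>
    (\<forall>a\<in>P. \<forall>b\<in>P. covers P le a b \<and> small_inf P le a b \<and> \<not> is_top P le a \<and> \<not> is_top P le b \<longrightarrow>
      (\<exists>u\<in>P. \<exists>f\<in>P. regular P le u \<and> le u a \<and> le u f \<and> \<not> le f a \<and> narrow P le u f))"

text \<open>
  Isomorphism invariance, also for order-reflecting maps that are not injective.
\<close>

lemma splits_image:
  assumes le: "\<And>a b. a \<in> P \<Longrightarrow> b \<in> P \<Longrightarrow> le' (h a) (h b) \<longleftrightarrow> le a b"
  shows "splits (h ` P) le' \<longleftrightarrow> splits P le"
proof -
  have is_top: "is_top (h ` P) le' (h a) \<longleftrightarrow> is_top P le a" if "a \<in> P" for a
    unfolding is_top_def using that by (simp add: le)
  have sup: "le_sup (h ` P) le' (h c) (h a) (h b) \<longleftrightarrow> le_sup P le c a b" if "a \<in> P" "b \<in> P" "c \<in> P" for a b c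
    unfolding le_sup_def using that by (simp add: le)
  have inf: "inf_le (h ` P) le' (h a) (h b) (h e) \<longleftrightarrow> inf_le P le a b e" if "a \<in> P" "b \<in> P" "e \<in> P" for a b e
    unfolding inf_le_def using that by (simp add: le)
  have cov: "covers (h ` P) le' (h a) (h b) \<longleftrightarrow> covers P le a b" if "a \<in> P" "b \<in> P" for a b
    unfolding covers_def using that by (simp add: sup)
  have small: "small_inf (h ` P) le' (h a) (h b) \<longleftrightarrow> small_inf P le a b" if "a \<in> P" "b \<in> P" for a b
    unfolding small_inf_def using that by (simp add: inf le is_top)
  have reg: "regular (h ` P) le' (h u) \<longleftrightarrow> regular P le u" if "u \<in> P" for u
    unfolding regular_def using that by (simp add: cov le is_top)
  have nar: "narrow (h ` P) le' (h u) (h f) \<longleftrightarrow> narrow P le u f" if "u \<in> P" "f \<in> P" for u f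
    unfolding narrow_def using that by (simp add: sup inf le)
  show ?thesis
    unfolding splits_def by (simp add: cov small is_top reg le nar)
qed

lemma coneD: "a \<in> cone k \<Longrightarrow> rate a" "a \<in> cone k \<Longrightarrow> a \<preceq> k" by (auto simp: cone_def)

lemma top_in_cone: "rate k \<Longrightarrow> k \<in> cone k" by (simp add: cone_def rle_refl)

lemma coneI_le: "rate a \<Longrightarrow> a \<preceq> b \<Longrightarrow> b \<in> cone k \<Longrightarrow> a \<in> cone k"
  by (auto simp: cone_def intro: rle_trans)

lemma max_in_cone: "a \<in> cone k \<Longrightarrow> b \<in> cone k \<Longrightarrow> rate k \<Longrightarrow> (\<lambda>v. max (a v) (b v)) \<in> cone k"
  by (simp add: cone_def rate_max max_rle rate_mono)

lemma min_in_cone: "a \<in> cone k \<Longrightarrow> b \<in> cone k \<Longrightarrow> (\<lambda>v. min (a v) (b v)) \<in> cone k"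
  by (rule coneI_le[of _ a]) (auto intro: rate_min rle_pointwise dest: coneD)

context
  fixes k assumes k: "rate k"
begin

lemma is_top_cone: "a \<in> cone k \<Longrightarrow> is_top (cone k) (\<preceq>) a \<longleftrightarrow> k \<preceq> a"
  unfolding is_top_def using top_in_cone[OF k] coneD(2) rle_trans by blast

lemma le_sup_cone:
  assumes "a \<in> cone k" "b \<in> cone k"
  shows "le_sup (cone k) (\<preceq>) c a b \<longleftrightarrow> c \<preceq> (\<lambda>v. max (a v) (b v))"
proof
  assume "le_sup (cone k) (\<preceq>) c a b"
  moreover have "a \<preceq> (\<lambda>v. max (a v) (b v))" "b \<preceq> (\<lambda>v. max (a v) (b v))"
    by (auto intro: rle_pointwise)
  ultimately show "c \<preceq> (\<lambda>v. max (a v) (b v))"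
    unfolding le_sup_def using max_in_cone[OF assms k] by blast
next
  assume c: "c \<preceq> (\<lambda>v. max (a v) (b v))"
  show "le_sup (cone k) (\<preceq>) c a b"
    unfolding le_sup_def
  proof (intro ballI impI)
    fix e assume e: "e \<in> cone k" "a \<preceq> e \<and> b \<preceq> e"
    then have "(\<lambda>v. max (a v) (b v)) \<preceq> e" by (intro max_rle) (auto intro: rate_mono coneD)
    then show "c \<preceq> e" by (rule rle_trans[OF c])
  qed
qed

lemma inf_le_cone:
  assumes "a \<in> cone k" "b \<in> cone k"
  shows "inf_le (cone k) (\<preceq>) a b e \<longleftrightarrow> (\<lambda>v. min (a v) (b v)) \<preceq> e"
proof
  assume "inf_le (cone k) (\<preceq>) a b e"
  moreover have "(\<lambda>v. min (a v) (b v)) \<preceq> a" "(\<lambda>v. min (a v) (b v)) \<preceq> b"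
    by (auto intro: rle_pointwise)
  ultimately show "(\<lambda>v. min (a v) (b v)) \<preceq> e"
    unfolding inf_le_def using min_in_cone[OF assms] by blast
next
  assume e: "(\<lambda>v. min (a v) (b v)) \<preceq> e"
  show "inf_le (cone k) (\<preceq>) a b e"
    unfolding inf_le_def
  proof (intro ballI impI)
    fix m assume "m \<in> cone k" "m \<preceq> a \<and> m \<preceq> b"
    then have "m \<preceq> (\<lambda>v. min (a v) (b v))"
      using assms by (intro rle_min) (auto intro: rate_mono coneD)
    then show "m \<preceq> e" using e by (rule rle_trans)
  qed
qed

lemma covers_cone:
  assumes "a \<in> cone k" "b \<in> cone k"
  shows "covers (cone k) (\<preceq>) a b \<longleftrightarrow> k \<preceq> (\<lambda>v. max (a v) (b v))"
  unfolding covers_def using le_sup_cone[OF assms] top_in_cone[OF k] coneD(2) rle_trans by blast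

lemma small_inf_cone:
  assumes "a \<in> cone k" "b \<in> cone k"
  shows "small_inf (cone k) (\<preceq>) a b \<longleftrightarrow>
    (\<forall>c\<in>cone k. k \<preceq> (\<lambda>v. max (min (a v) (b v)) (c v)) \<longrightarrow> k \<preceq> c)"
proof -
  have "(\<forall>e\<in>cone k. inf_le (cone k) (\<preceq>) a b e \<and> c \<preceq> e \<longrightarrow> is_top (cone k) (\<preceq>) e)
      \<longleftrightarrow> k \<preceq> (\<lambda>v. max (min (a v) (b v)) (c v))" if c: "c \<in> cone k" for c
  proof -
    have "(\<forall>e\<in>cone k. inf_le (cone k) (\<preceq>) a b e \<and> c \<preceq> e \<longrightarrow> is_top (cone k) (\<preceq>) e)
      \<longleftrightarrow> le_sup (cone k) (\<preceq>) k (\<lambda>v. min (a v) (b v)) c"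
      unfolding le_sup_def by (auto simp: inf_le_cone[OF assms] is_top_cone)
    then show ?thesis using le_sup_cone[OF min_in_cone[OF assms] c] by simp
  qed
  then show ?thesis unfolding small_inf_def by (auto simp: is_top_cone)
qed

lemma regular_cone:
  assumes "u \<in> cone k"
  shows "regular (cone k) (\<preceq>) u \<longleftrightarrow>
    (\<exists>c\<in>cone k. \<not> k \<preceq> c \<and> k \<preceq> (\<lambda>v. max (u v) (c v)) \<and>
      (\<forall>w\<in>cone k. k \<preceq> (\<lambda>v. max (w v) (c v)) \<longrightarrow> u \<preceq> w))"
  unfolding regular_def using assms by (auto simp: is_top_cone covers_cone)

lemma narrow_cone:
  "narrow (cone k) (\<preceq>) u f \<longleftrightarrow>
    (\<forall>c\<in>cone k. \<forall>d\<in>cone k. c \<preceq> f \<and> d \<preceq> f \<longrightarrow>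
      (\<exists>c'\<in>cone k. \<exists>d'\<in>cone k. c \<preceq> (\<lambda>v. max (d v) (c' v)) \<and> d \<preceq> (\<lambda>v. max (c v) (d' v))
        \<and> (\<lambda>v. min (c' v) (d' v)) \<preceq> u))"
  unfolding narrow_def by (simp add: le_sup_cone inf_le_cone cong: ball_cong bex_cong conj_cong)

end

section \<open>Steps of height one\<close>

text \<open>
  The running maximum of \<open>c\<close> over the arguments where it exceeds \<open>d\<close>. Up to a lower bound \<open>w\<close> this is the
  witness for the difference \<open>c - d\<close> in \<open>narrow\<close>.
\<close>

primrec lead :: "(nat \<Rightarrow> nat) \<Rightarrow> (nat \<Rightarrow> nat) \<Rightarrow> nat \<Rightarrow> nat" where
  "lead c d 0 = (if d 0 < c 0 then c 0 else 0)"
| "lead c d (Suc v) = (if d (Suc v) < c (Suc v) then max (c (Suc v)) (lead c d v) else lead c d v)"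

lemma lead_ge: "d v < c v \<Longrightarrow> c v \<le> lead c d v" by (cases v) auto

lemma lead_mono: "mono (lead c d)" unfolding mono_iff_le_Suc by auto

lemma lead_cases: "lead c d v = 0 \<or> (\<exists>w\<le>v. d w < c w \<and> lead c d v = c w)"
proof (induction v)
  case (Suc v)
  then show ?case by (auto simp: max_def intro: le_SucI)
qed auto

lemma lead_le: "mono c \<Longrightarrow> lead c d v \<le> c v"
  using lead_cases[of c d v] monoD[of c _ v] by fastforce

lemma prim_rec1_lead: "prim_rec1 c \<Longrightarrow> prim_rec1 d \<Longrightarrow> prim_rec1 (lead c d)"
  by (rule prim_rec1_rec[of _ _ "\<lambda>v r. if d (Suc v) < c (Suc v) then max (c (Suc v)) r else r"])
    (auto intro!: PR_if PRP_less PR_max PR_Suc PR_nth intro: PR_app1[of c] PR_app1[of d])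

text \<open>
  A step of at most one is narrow. After a delay, both \<open>c\<close> and \<open>d\<close> are at most \<open>w + 1\<close> for a rate \<open>w \<preceq> u\<close>. If
  both leads exceed \<open>w\<close> at \<open>v\<close>, then each of \<open>c\<close> and \<open>d\<close> takes the value \<open>w v + 1\<close> strictly above the other
  one. The one that takes it first keeps at least this value, so the other one cannot exceed it later.
\<close>

lemma narrow_if_step:
  assumes k: "rate k" and u: "u \<in> cone k" and f: "f \<in> cone k" and step: "\<And>v. f v \<le> Suc (u v)"
  shows "narrow (cone k) (\<preceq>) u f"
  unfolding narrow_cone[OF k]
proof (intro ballI impI)
  fix c d assume c: "c \<in> cone k" and d: "d \<in> cone k" and "c \<preceq> f \<and> d \<preceq> f"
  then obtain g h where gh: "pace g" "\<And>v. c v \<le> f (g v)" "pace h" "\<And>v. d v \<le> f (h v)"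
    using rleE[OF _ rate_mono[OF coneD(1)[OF f]]] by metis
  define p where "p v = max (g v) (h v)" for v
  define w where "w v = u (p v)" for v
  have p: "pace p" unfolding p_def by (rule pace_max[OF gh(1,3)])
  have w: "rate w" unfolding w_def by (rule rate_delay[OF coneD(1)[OF u] p])
  have wu: "w \<preceq> u" unfolding w_def by (rule rleI[OF p]) simp
  have le: "c v \<le> Suc (w v)" "d v \<le> Suc (w v)" for v
    using gh(2,4)[of v] step[of "p v"] rate_monoD[OF coneD(1)[OF f], of "g v" "p v"]
      rate_monoD[OF coneD(1)[OF f], of "h v" "p v"] unfolding w_def p_def by auto
  have m: "mono c" "mono d" using c d by (auto intro: rate_mono coneD)
  have pr: "prim_rec1 c" "prim_rec1 d" using c d by (auto intro: rate_prim_rec1 coneD)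
  define c' where "c' v = max (w v) (lead c d v)" for v
  define d' where "d' v = max (w v) (lead d c v)" for v
  have wk: "w \<in> cone k" by (rule coneI_le[OF w wu u])
  have c': "c' \<in> cone k"
  proof (rule coneI_le)
    show "rate c'" unfolding c'_def using w prim_rec1_lead[OF pr] lead_mono by (rule rate_max_mono)
    show "c' \<preceq> (\<lambda>v. max (w v) (c v))"
      unfolding c'_def using lead_le[OF m(1)] by (intro rle_pointwise max.mono) auto
    show "(\<lambda>v. max (w v) (c v)) \<in> cone k" by (rule max_in_cone[OF wk c k])
  qed
  have d': "d' \<in> cone k"
  proof (rule coneI_le)
    show "rate d'" unfolding d'_def using w prim_rec1_lead[OF pr(2,1)] lead_mono by (rule rate_max_mono)
    show "d' \<preceq> (\<lambda>v. max (w v) (d v))"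
      unfolding d'_def using lead_le[OF m(2)] by (intro rle_pointwise max.mono) auto
    show "(\<lambda>v. max (w v) (d v)) \<in> cone k" by (rule max_in_cone[OF wk d k])
  qed
  have 1: "c \<preceq> (\<lambda>v. max (d v) (c' v))"
    using lead_ge[of d _ c] by (intro rle_pointwise) (auto simp: c'_def le_max_iff_disj not_le)
  have 2: "d \<preceq> (\<lambda>v. max (c v) (d' v))"
    using lead_ge[of c _ d] by (intro rle_pointwise) (auto simp: d'_def le_max_iff_disj not_le)
  have "min (lead c d v) (lead d c v) \<le> w v" for v
  proof (rule ccontr)
    assume no: "\<not> min (lead c d v) (lead d c v) \<le> w v"
    then obtain x where x: "x \<le> v" "d x < c x" "lead c d v = c x" using lead_cases[of c d v] by auto
    obtain y where y: "y \<le> v" "c y < d y" "lead d c v = d y" using lead_cases[of d c v] no by auto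
    have "w x \<le> w v" "w y \<le> w v" using x(1) y(1) w by (auto intro: rate_monoD)
    then have eq: "c x = Suc (w v)" "d y = Suc (w v)"
      using no x(3) y(3) le(1)[of x] le(2)[of y] by auto
    show False
    proof (cases "x \<le> y")
      case True
      then show False using monoD[OF m(1), of x y] eq y(2) by simp
    next
      case False
      then show False using monoD[OF m(2), of y x] eq x(2) by simp
    qed
  qed
  then have "(\<lambda>v. min (c' v) (d' v)) \<preceq> w"
    by (intro rle_pointwise) (auto simp: c'_def d'_def min_le_iff_disj)
  then have 3: "(\<lambda>v. min (c' v) (d' v)) \<preceq> u" using wu by (rule rle_trans)
  show "\<exists>c'\<in>cone k. \<exists>d'\<in>cone k. c \<preceq> (\<lambda>v. max (d v) (c' v)) \<and> d \<preceq> (\<lambda>v. max (c v) (d' v))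
        \<and> (\<lambda>v. min (c' v) (d' v)) \<preceq> u"
    using c' d' 1 2 3 by blast
qed

section \<open>Following a rate on a set\<close>

primrec jump :: "(nat \<Rightarrow> nat) \<Rightarrow> nat set \<Rightarrow> nat \<Rightarrow> nat" where
  "jump k T 0 = (if 0 \<in> T then k 0 else 0)"
| "jump k T (Suc v) = (if Suc v \<in> T then k (Suc v) else jump k T v)"

lemma jump_at: "w \<in> T \<Longrightarrow> jump k T w = k w" by (cases w) auto

lemma jump_cases:
  "(jump k T v = 0 \<and> (\<forall>w\<le>v. w \<notin> T)) \<or>
   (\<exists>w\<le>v. w \<in> T \<and> jump k T v = k w \<and> (\<forall>u. w < u \<and> u \<le> v \<longrightarrow> u \<notin> T))"
proof (induction v)
  case (Suc v)
  then show ?case by (auto simp: le_Suc_eq)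
qed auto

lemma jump_le: "mono k \<Longrightarrow> jump k T v \<le> k v"
  using jump_cases[of k T v] monoD[of k _ v] by fastforce

lemma jump_mono: assumes "mono k" shows "mono (jump k T)"
  unfolding mono_iff_le_Suc
proof
  fix v
  have "jump k T v \<le> k (Suc v)" using jump_le[OF assms, of T v] monoD[OF assms, of v "Suc v"] by simp
  then show "jump k T v \<le> jump k T (Suc v)" by simp
qed

lemma jump_ge: "mono k \<Longrightarrow> w \<in> T \<Longrightarrow> w \<le> v \<Longrightarrow> k w \<le> jump k T v"
  using monoD[OF jump_mono, of k w v T] jump_at[of w T k] by simp

lemma jump_const: "u \<le> v \<Longrightarrow> (\<And>w. u < w \<Longrightarrow> w \<le> v \<Longrightarrow> w \<notin> T) \<Longrightarrow> jump k T v = jump k T u"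
  by (induction v rule: dec_induct) auto

lemma prim_rec1_jump: "prim_rec1 k \<Longrightarrow> prim_rec_set T \<Longrightarrow> prim_rec1 (jump k T)"
  by (rule prim_rec1_rec[of _ _ "\<lambda>v r. if Suc v \<in> T then k (Suc v) else r"])
    (auto intro!: PR_if PRP_in PR_Suc PR_nth intro: PR_app1[of k])

lemma rate_jump:
  assumes "rate k" "prim_rec_set T" "infinite T" shows "rate (jump k T)"
  unfolding rate_def
proof (intro conjI allI)
  show "prim_rec1 (jump k T)" using assms by (intro prim_rec1_jump rate_prim_rec1)
  show "mono (jump k T)" using assms by (intro jump_mono rate_mono)
  fix n
  obtain v where v: "n \<le> k v" using assms(1) unfolding rate_def by blast
  obtain w where "w \<in> T" "v < w" using assms(3) infinite_nat_iff_unbounded by blast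
  then show "\<exists>v. n \<le> jump k T v"
    using v rate_monoD[OF assms(1), of v w] by (intro exI[of _ w]) (simp add: jump_at)
qed

lemma jump_in_cone: "rate k \<Longrightarrow> prim_rec_set T \<Longrightarrow> infinite T \<Longrightarrow> jump k T \<in> cone k"
  by (simp add: cone_def rate_jump rle_pointwise jump_le rate_mono)

section \<open>Slow sets\<close>

lemma cnt_const: "u \<le> v \<Longrightarrow> (\<And>w. u < w \<Longrightarrow> w \<le> v \<Longrightarrow> w \<in> X) \<Longrightarrow> cnt X v = cnt X u"
  by (induction v rule: dec_induct) auto

lemma last_element:
  "0 < cnt X v \<Longrightarrow> \<exists>z\<le>v. z \<notin> X \<and> cnt X z = cnt X v \<and> (\<forall>w. z < w \<and> w \<le> v \<longrightarrow> w \<in> X)"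
proof (induction v)
  case (Suc v)
  show ?case
  proof (cases "Suc v \<in> X")
    case True
    then obtain z where "z \<le> v" "z \<notin> X" "cnt X z = cnt X v" "\<forall>w. z < w \<and> w \<le> v \<longrightarrow> w \<in> X"
      using Suc by auto
    then show ?thesis using True by (intro exI[of _ z]) (auto simp: le_Suc_eq)
  qed auto
qed (auto split: if_splits)

text \<open>
  A counting function changes only at elements of the complement, so it suffices to compare rates there.
\<close>

lemma rle_on_elements:
  assumes k: "rate (cnt X)" and l: "rate l" and g: "pace g"
    and le: "\<And>z. N \<le> z \<Longrightarrow> z \<notin> X \<Longrightarrow> cnt X z \<le> l (g z)"
  shows "cnt X \<preceq> l"
proof -
  obtain M where M: "Suc (cnt X N) \<le> cnt X M" using k unfolding rate_def by blast
  have "cnt X v \<le> l (g v)" if "M \<le> v" for v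
  proof -
    have v: "cnt X N < cnt X v" using M cnt_le[OF that, of X] by simp
    then obtain z where z: "z \<le> v" "z \<notin> X" "cnt X z = cnt X v" using last_element[of X v] by auto
    have "N \<le> z" using v z(3) cnt_le[of z N X] by (metis leI less_imp_le not_le)
    then have "cnt X z \<le> l (g z)" using z(2) by (rule le)
    also have "\<dots> \<le> l (g v)" using z(1) by (intro rate_monoD[OF l] paceD(2)[OF g])
    finally show ?thesis using z(3) by simp
  qed
  then show ?thesis by (rule rle_eventually[OF k l g])
qed

text \<open>
  Slowness in terms of \<open>cnt\<close>: the element of the complement after \<open>z\<close> is larger than \<open>g z\<close>, so nothing is
  counted in between.
\<close>

lemma slow_gap:
  assumes "slow X" "pace g"
  shows "\<exists>N. \<forall>z\<ge>N. z \<notin> X \<longrightarrow> cnt X (g z) = cnt X z"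
proof -
  have inf: "infinite (- X)" using assms by (simp add: slow_def)
  have "\<forall>\<^sub>\<infinity>n. enumerate (- X) (Suc n) > g (enumerate (- X) n)"
    using assms paceD(1) unfolding slow_def by blast
  then obtain m where m: "\<And>n. m < n \<Longrightarrow> g (enumerate (- X) n) < enumerate (- X) (Suc n)"
    unfolding MOST_nat by blast
  have "cnt X (g z) = cnt X z" if z: "enumerate (- X) (Suc m) \<le> z" "z \<notin> X" for z
  proof (rule cnt_const)
    show "z \<le> g z" by (rule paceD(3)[OF assms(2)])
    fix w assume w: "z < w" "w \<le> g z"
    show "w \<in> X"
    proof (rule ccontr)
      assume "w \<notin> X"
      obtain n where n: "enumerate (- X) n = z" using enumerate_Ex[of "- X" z] z(2) inf by auto
      have "m < n" using z(1) n inf by (metis Suc_le_eq enumerate_mono_le_iff)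
      have "enumerate (- X) (Suc n) \<le> w"
        unfolding enumerate_Suc''[OF inf] using \<open>w \<notin> X\<close> w(1) n by (intro Least_le) auto
      then show False using m[OF \<open>m < n\<close>] n w(2) by simp
    qed
  qed
  then show ?thesis by blast
qed

text \<open>
  This rate lags one behind \<open>k\<close> where \<open>jump k T\<close> agrees with \<open>k\<close>. For slow \<open>X\<close> it makes
  \<open>jump (cnt X) W\<close> regular: the two together reach \<open>cnt X\<close>, and the notch after an element of \<open>W\<close> lasts
  longer than any pace (\<open>notch_late\<close>), so a rate that completes it to the top has to supply the missing
  value at all but finitely many elements of \<open>W\<close>.
\<close>

definition notch :: "(nat \<Rightarrow> nat) \<Rightarrow> nat set \<Rightarrow> nat \<Rightarrow> nat" where
  "notch k T v = (if jump k T v = k v then k v - 1 else k v)"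

context
  fixes X W :: "nat set"
  assumes X: "slow X" and W: "prim_rec_set W" "infinite W" "W \<inter> X = {}"
begin

lemma rate_X: "rate (cnt X)" using X by (auto simp: slow_def intro: rate_cnt)

lemma notch_le: "notch (cnt X) W v \<le> cnt X v" by (simp add: notch_def)

lemma notch_in_cone: "notch (cnt X) W \<in> cone (cnt X)"
proof -
  have "prim_rec1 (notch (cnt X) W)"
    unfolding prim_rec1_iff notch_def
    using prim_rec1_cnt[of X] prim_rec1_jump[OF prim_rec1_cnt W(1), of X] X
    by (intro PR_if PRP_eq PR_diff PR_const) (auto simp: prim_rec1_iff slow_def)
  moreover have "mono (notch (cnt X) W)"
  proof (rule monoI)
    fix u v :: nat assume uv: "u \<le> v"
    show "notch (cnt X) W u \<le> notch (cnt X) W v"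
    proof (cases "cnt X u = cnt X v")
      case False
      then have "cnt X u < cnt X v" using cnt_le[OF uv, of X] by simp
      then show ?thesis using notch_le[of u] by (auto simp: notch_def)
    next
      case eq: True
      have "jump (cnt X) W u = cnt X u" if j: "jump (cnt X) W v = cnt X v" "0 < cnt X v"
      proof -
        obtain w where w: "w \<le> v" "w \<in> W" "cnt X w = cnt X v"
          using jump_cases[of "cnt X" W v] j by auto
        \<comment> \<open>otherwise \<open>w\<close>, which is not in \<open>X\<close>, would be counted between \<open>u\<close> and \<open>v\<close>\<close>
        have "w \<le> u" using cnt_less[of u w X] w eq W(3) by (metis disjoint_iff less_irrefl not_le)
        then show ?thesis using jump_ge[OF cnt_mono w(2), of u X] jump_le[OF cnt_mono, of X W u] w(3) eq by simp
      qed
      then show ?thesis using eq by (cases "cnt X v = 0") (auto simp: notch_def)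
    qed
  qed
  moreover have "\<exists>v. n \<le> notch (cnt X) W v" for n
  proof -
    obtain v where "Suc n \<le> cnt X v" using rate_X unfolding rate_def by blast
    then show ?thesis by (intro exI[of _ v]) (auto simp: notch_def)
  qed
  ultimately show ?thesis
    using notch_le by (simp add: cone_def rate_def rle_pointwise)
qed

lemma notch_late:
  assumes "pace g" shows "\<exists>N. \<forall>w\<in>W. N \<le> w \<longrightarrow> notch (cnt X) W (g w) < cnt X w"
proof -
  obtain N where N: "\<And>z. N \<le> z \<Longrightarrow> z \<notin> X \<Longrightarrow> cnt X (g z) = cnt X z"
    using slow_gap[OF X assms] by blast
  have "notch (cnt X) W (g w) < cnt X w" if w: "w \<in> W" "N \<le> w" for w
  proof -
    have "w \<notin> X" using w W by auto
    then have eq: "cnt X (g w) = cnt X w" using N w by simp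
    have "jump (cnt X) W (g w) = cnt X (g w)"
      using jump_ge[OF cnt_mono w(1) paceD(3)[OF assms], of X] jump_le[OF cnt_mono, of X W "g w"] eq by simp
    then show ?thesis using eq cnt_pos[OF \<open>w \<notin> X\<close>] by (simp add: notch_def)
  qed
  then show ?thesis by blast
qed

lemma notch_not_top: "\<not> cnt X \<preceq> notch (cnt X) W"
proof
  assume "cnt X \<preceq> notch (cnt X) W"
  then obtain g where g: "pace g" "\<And>v. cnt X v \<le> notch (cnt X) W (g v)"
    using rleE coneD(1)[OF notch_in_cone] rate_mono by blast
  obtain N where N: "\<And>w. w \<in> W \<Longrightarrow> N \<le> w \<Longrightarrow> notch (cnt X) W (g w) < cnt X w"
    using notch_late[OF g(1)] by blast
  obtain w where "w \<in> W" "N < w" using W(2) infinite_nat_iff_unbounded by blast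
  then show False using N[of w] g(2)[of w] by simp
qed

lemma regular_jump: "regular (cone (cnt X)) (\<preceq>) (jump (cnt X) W)"
proof -
  have "cnt X \<preceq> (\<lambda>v. max (jump (cnt X) W v) (notch (cnt X) W v))"
    by (rule rle_pointwise) (simp add: notch_def)
  moreover have "jump (cnt X) W \<preceq> l"
    if l: "l \<in> cone (cnt X)" and cov: "cnt X \<preceq> (\<lambda>v. max (l v) (notch (cnt X) W v))" for l
  proof -
    have r: "rate l" "rate (notch (cnt X) W)" using l notch_in_cone by (auto dest: coneD)
    obtain g where g: "pace g" "\<And>v. cnt X v \<le> max (l (g v)) (notch (cnt X) W (g v))"
      using rleE[OF cov rate_mono[OF rate_max[OF r]]] by blast
    obtain N where N: "\<And>w. w \<in> W \<Longrightarrow> N \<le> w \<Longrightarrow> notch (cnt X) W (g w) < cnt X w"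
      using notch_late[OF g(1)] by blast
    obtain w0 where w0: "w0 \<in> W" "N < w0" using W(2) infinite_nat_iff_unbounded by blast
    have "jump (cnt X) W v \<le> l (g v)" if v: "w0 \<le> v" for v
    proof -
      obtain w where w: "w \<le> v" "w \<in> W" "jump (cnt X) W v = cnt X w" "\<And>u. w < u \<Longrightarrow> u \<le> v \<Longrightarrow> u \<notin> W"
        using jump_cases[of "cnt X" W v] w0 v by blast
      have "w0 \<le> w" using w(4)[of w0] w0 v by (meson not_le)
      then have "notch (cnt X) W (g w) < cnt X w" using N[OF w(2)] w0 by simp
      then have "cnt X w \<le> l (g w)" using g(2)[of w] by auto
      also have "\<dots> \<le> l (g v)" using w(1) by (intro rate_monoD[OF r(1)] paceD(2)[OF g(1)])
      finally show ?thesis using w(3) by simp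
    qed
    then show ?thesis by (rule rle_eventually[OF rate_jump[OF rate_X W(1,2)] r(1) g(1)])
  qed
  ultimately show ?thesis
    unfolding regular_cone[OF rate_X jump_in_cone[OF rate_X W(1,2)]]
    using notch_in_cone notch_not_top by blast
qed

end

text \<open>
  Let \<open>k = cnt X\<close> be the maximum of \<open>a\<close> and \<open>b\<close> up to a pace \<open>g\<close>, let \<open>S\<close> be the set of elements at which
  \<open>a\<close> catches up, and \<open>S'\<close> the set of the others, at which \<open>b\<close> does. Take \<open>u = jump k S\<close> and
  \<open>f = min k (u + 1)\<close>. Then \<open>u\<close> is regular and below \<open>a\<close>, and the step to \<open>f\<close> has height one. It remains to
  see that \<open>f\<close> is not below \<open>a\<close>. At the first element of \<open>S'\<close> after an element of \<open>S\<close>, \<open>f\<close> agrees with \<open>k\<close>.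
  But \<open>a\<close> catches up with \<open>k\<close> only at finitely many elements of \<open>S'\<close>, at whatever pace \<open>h\<close>. Otherwise, at
  infinitely many elements \<open>W\<close> both \<open>a\<close> and \<open>b\<close> catch up, so \<open>a \<sqinter> b\<close> together with the notch at \<open>W\<close> gives
  the top, contrary to the smallness of \<open>a \<sqinter> b\<close>.
\<close>

theorem splits_if_slow:
  assumes X: "slow X" shows "splits (cone (cnt X)) (\<preceq>)"
  unfolding splits_def
proof (intro ballI impI)
  let ?k = "cnt X"
  have pX: "prim_rec_set X" and infX: "infinite (- X)" using X by (auto simp: slow_def)
  have k: "rate ?k" using pX infX by (rule rate_cnt)
  fix a b assume a: "a \<in> cone ?k" and b: "b \<in> cone ?k"
  assume "covers (cone ?k) (\<preceq>) a b \<and> small_inf (cone ?k) (\<preceq>) a b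
    \<and> \<not> is_top (cone ?k) (\<preceq>) a \<and> \<not> is_top (cone ?k) (\<preceq>) b"
  then have cov: "?k \<preceq> (\<lambda>v. max (a v) (b v))"
    and small: "\<And>c. c \<in> cone ?k \<Longrightarrow> ?k \<preceq> (\<lambda>v. max (min (a v) (b v)) (c v)) \<Longrightarrow> ?k \<preceq> c"
    and na: "\<not> ?k \<preceq> a" and nb: "\<not> ?k \<preceq> b"
    using a b by (auto simp: covers_cone[OF k] small_inf_cone[OF k] is_top_cone[OF k])
  have ra: "rate a" and rb: "rate b" using a b by (auto dest: coneD)
  obtain g where g: "pace g" "\<And>v. ?k v \<le> max (a (g v)) (b (g v))"
    using rleE[OF cov rate_mono[OF rate_max[OF ra rb]]] by blast
  define S where "S = {z. z \<notin> X \<and> ?k z \<le> a (g z)}"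
  define S' where "S' = {z. z \<notin> X \<and> z \<notin> S}"
  have PRk: "PR 1 (\<lambda>xs. ?k (xs ! 0))" using prim_rec1_cnt[OF pX] by (simp add: prim_rec1_iff)
  have pS: "prim_rec_set S"
    unfolding prim_rec_set_def prim_rec1_iff S_def mem_Collect_eq
    by (intro PR_if PRP_conj PRP_not PRP_in PRP_le PR_const PR_nth PRk PR_delay ra g pX) simp
  have b_S': "?k z \<le> b (g z)" if "z \<in> S'" for z
    using that g(2)[of z] by (auto simp: S'_def S_def)
  have unb: "\<exists>z\<ge>N. z \<notin> X \<and> l (g z) < ?k z" if "\<not> ?k \<preceq> l" "rate l" for l N
    using rle_on_elements[OF k that(2) g(1), of N] that(1) not_le by blast
  \<comment> \<open>\<open>S\<close> is infinite because \<open>b\<close> is not the top, and \<open>S'\<close> because \<open>a\<close> is not\<close>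
  have "\<exists>z>n. z \<in> S" for n
  proof -
    obtain z where "z \<ge> Suc n" "z \<notin> X" "b (g z) < ?k z" using unb[OF nb rb] by blast
    then show ?thesis using b_S'[of z] by (intro exI[of _ z]) (auto simp: S'_def)
  qed
  then have infS: "infinite S" using infinite_nat_iff_unbounded by blast
  have S'_large: "\<exists>z>n. z \<in> S'" for n
  proof -
    obtain z where "z \<ge> Suc n" "z \<notin> X" "a (g z) < ?k z" using unb[OF na ra] by blast
    then show ?thesis by (intro exI[of _ z]) (auto simp: S'_def S_def)
  qed
  have finite_W: "finite {z. z \<in> S' \<and> ?k z \<le> a (h z)}" (is "finite ?W") if h: "pace h" for h
  proof (rule ccontr)
    assume inf: "infinite ?W"
    have W: "prim_rec_set ?W" "?W \<inter> X = {}"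
      unfolding prim_rec_set_def prim_rec1_iff S'_def mem_Collect_eq
      by (intro PR_if PRP_conj PRP_not PRP_in PRP_le PR_const PR_nth PRk PR_delay ra h pX pS; simp) auto
    let ?c = "notch ?k ?W"
    have "?k v \<le> max (min (a (max (g v) (h v))) (b (max (g v) (h v)))) (?c (max (g v) (h v)))" for v
    proof (cases "jump ?k ?W v = ?k v \<and> 0 < ?k v")
      case True
      then obtain w where w: "w \<le> v" "w \<in> ?W" "?k v = ?k w" using jump_cases[of ?k ?W v] by auto
      have "?k w \<le> a (h w)" "?k w \<le> b (g w)" using w(2) b_S' by auto
      moreover have "a (h w) \<le> a (max (g v) (h v))" "b (g w) \<le> b (max (g v) (h v))"
        using w(1) paceD(2)[OF h, of w v] paceD(2)[OF g(1), of w v]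
        by (auto intro!: rate_monoD[OF ra] rate_monoD[OF rb] simp: le_max_iff_disj)
      ultimately show ?thesis using w(3) by auto
    next
      case False
      then have "?k v = ?c v" by (auto simp: notch_def)
      also have "\<dots> \<le> ?c (max (g v) (h v))"
        using paceD(3)[OF h, of v]
        by (intro rate_monoD[OF coneD(1)[OF notch_in_cone[OF X W(1) inf W(2)]]]) (simp add: le_max_iff_disj)
      finally show ?thesis by simp
    qed
    then have "?k \<preceq> (\<lambda>v. max (min (a v) (b v)) (?c v))" by (rule rleI[OF pace_max[OF g(1) h]])
    then show False
      using small[OF notch_in_cone[OF X W(1) inf W(2)]] notch_not_top[OF X W(1) inf W(2)] by blast
  qed
  define u where "u = jump ?k S"
  define f where "f v = min (?k v) (Suc (u v))" for v
  have u: "u \<in> cone ?k" unfolding u_def by (rule jump_in_cone[OF k pS infS])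
  have ru: "rate u" using u by (rule coneD)
  have f: "f \<in> cone ?k"
  proof (rule coneI_le[OF _ _ top_in_cone[OF k]])
    show "rate f"
      unfolding f_def
    proof (rule rate_min[OF k])
      show "rate (\<lambda>v. Suc (u v))"
        using ru unfolding rate_def prim_rec1_iff
        by (auto intro!: PR_Suc simp: mono_def) (meson le_SucI)
    qed
    show "f \<preceq> ?k" unfolding f_def by (rule rle_pointwise) simp
  qed
  have "S \<inter> X = {}" by (auto simp: S_def)
  then have "regular (cone ?k) (\<preceq>) u" unfolding u_def by (rule regular_jump[OF X pS infS])
  moreover have "u \<preceq> a"
  proof (rule rleI[OF g(1)])
    fix v
    show "u v \<le> a (g v)"
    proof (cases "u v = 0")
      case False
      then obtain w where w: "w \<le> v" "w \<in> S" "u v = ?k w"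
        using jump_cases[of ?k S v] unfolding u_def by auto
      then have "?k w \<le> a (g w)" by (simp add: S_def)
      also have "\<dots> \<le> a (g v)" using w(1) by (intro rate_monoD[OF ra] paceD(2)[OF g(1)])
      finally show ?thesis using w(3) by simp
    qed simp
  qed
  moreover have "u \<preceq> f"
    by (rule rle_pointwise) (simp add: f_def u_def jump_le cnt_mono le_SucI)
  moreover have "\<not> f \<preceq> a"
  proof
    assume "f \<preceq> a"
    then obtain h where h: "pace h" "\<And>v. f v \<le> a (h v)" using rleE rate_mono[OF ra] by blast
    obtain n where n: "\<And>z. z \<in> S' \<Longrightarrow> ?k z \<le> a (h z) \<Longrightarrow> z \<le> n"
      using finite_W[OF h(1)] unfolding finite_nat_set_iff_bounded_le by auto
    obtain s where s: "s > n" "s \<in> S" using infS infinite_nat_iff_unbounded by blast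
    \<comment> \<open>the last element \<open>y\<close> of the complement before \<open>z\<close> belongs to \<open>S\<close>,
      so \<open>u\<close> is only one below \<open>k\<close> at \<open>z\<close>\<close>
    define z where "z = (LEAST z. s < z \<and> z \<in> S')"
    have z: "s < z" "z \<in> S'" using LeastI_ex[OF S'_large[of s]] unfolding z_def by auto
    have before: "y \<in> S" if "s < y" "y < z" "y \<notin> X" for y
      using not_less_Least[of y "\<lambda>z. s < z \<and> z \<in> S'"] that unfolding z_def S'_def by blast
    have zX: "z \<notin> X" using z(2) by (simp add: S'_def)
    obtain z' where z': "z = Suc z'" using z(1) by (cases z) auto
    have "0 < ?k z'" using cnt_le[of s z' X] cnt_pos[of s X] s(2) z(1) z' by (auto simp: S_def)
    then obtain y where y: "y \<le> z'" "y \<notin> X" "?k y = ?k z'" "\<forall>w. y < w \<and> w \<le> z' \<longrightarrow> w \<in> X"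
      using last_element by blast
    have "y \<in> S"
    proof (cases "s < y")
      case False
      then have "y = s" using y(4) s(2) z(1) z' by (auto simp: S_def) (metis less_Suc_eq_le linorder_neqE_nat)
      then show ?thesis using s(2) by simp
    qed (use before y z' in auto)
    then have "?k z' \<le> u z'" unfolding u_def using jump_ge[OF cnt_mono, of y S z' X] y by simp
    also have "\<dots> \<le> u z" using z' by (intro rate_monoD[OF ru]) simp
    finally have "f z = ?k z" using zX z' by (simp add: f_def)
    then have "?k z \<le> a (h z)" using h(2)[of z] by simp
    then show False using n[OF z(2)] z(1) s(1) by simp
  qed
  moreover have "narrow (cone ?k) (\<preceq>) u f"
    by (rule narrow_if_step[OF k u f]) (simp add: f_def)
  ultimately show "\<exists>u\<in>cone ?k. \<exists>f\<in>cone ?k. regular (cone ?k) (\<preceq>) u \<and> u \<preceq> a \<and> u \<preceq> f \<and> \<not> f \<preceq> a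
      \<and> narrow (cone ?k) (\<preceq>) u f"
    using u f by blast
qed

section \<open>Steps of height two over long stretches\<close>

text \<open>
  The opposite situation: \<open>f\<close> exceeds \<open>e = jump k T\<close> by at least two at some late \<open>v\<close>, and \<open>e\<close>
  remains constant on \<open>{v..g v}\<close>, for every pace \<open>g\<close>. The pair \<open>one_up\<close>, \<open>two_up\<close> shows that \<open>f\<close> is not narrow over
  \<open>e\<close>. Consider a stretch of arguments on which \<open>e\<close> has a constant value \<open>n\<close> and which starts
  at the first \<open>b\<close> with \<open>f b \<ge> n + 2\<close>. From \<open>b\<close> on, \<open>one_up\<close> is \<open>n + 1\<close>, whereas \<open>two_up\<close> stays at \<open>n\<close>
  until \<open>ack j b\<close>, where it rises to \<open>n + 2\<close>. If that delay beats the given pace, then \<open>one_up\<close> exceeds \<open>two_up\<close>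
  first and \<open>two_up\<close> exceeds \<open>one_up\<close> later on the same stretch. So both differences exceed \<open>n\<close> there, and
  their infimum does, too.

  The delay has to beat every primitive recursive pace eventually, so the level \<open>j\<close> must grow, and it may
  grow only when a stretch long enough for the present level has been used up. The stretches of the
  hypothesis exist for each level, but there is no primitive recursive bound on when they occur. So the
  construction waits: the level is a \<open>phase\<close> that increases once a stretch of length \<open>ack (j + 2) b\<close> has been
  seen. This is decidable primitive recursively because the graph of \<open>ack\<close> is.
\<close>

locale wide =
  fixes k :: "nat \<Rightarrow> nat" and T :: "nat set" and f :: "nat \<Rightarrow> nat"
  assumes k: "rate k" and T: "prim_rec_set T" "infinite T"
    and f: "rate f" and ef: "\<And>v. jump k T v \<le> f v" and fk: "\<And>v. f v \<le> k v"
    and wide: "\<And>g N. pace g \<Longrightarrow> \<exists>v\<ge>N. Suc (Suc (jump k T v)) \<le> f v \<and> jump k T (g v) = jump k T v"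
begin

abbreviation "e \<equiv> jump k T"

text \<open>
  The start of the present stretch, by \<open>base_eq\<close>. The count is used because it is visibly primitive
  recursive.
\<close>

definition "base v = (\<Sum>i<Suc v. if f i < Suc (Suc (e v)) then 1 else (0::nat))"

primrec phase :: "nat \<Rightarrow> nat" where
  "phase 0 = 0"
| "phase (Suc v) = (if Suc (Suc (e v)) \<le> f v \<and> ack (Suc (Suc (phase v))) (base v) \<le> v
     then Suc (phase v) else phase v)"

definition "late v = (if Suc (Suc (e v)) \<le> f v \<and> ack (phase v) (base v) \<le> v then Suc (Suc (e v)) else 0)"

definition "one_up v = min (f v) (Suc (e v))"
definition "two_up v = max (e v) (lead late (\<lambda>_. 0) v)"

lemma rate_e: "rate e" using k T by (rule rate_jump)

lemma base_eq: "Suc (Suc (e v)) \<le> f v \<Longrightarrow> base v = (LEAST i. Suc (Suc (e v)) \<le> f i)"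
  unfolding base_def by (rule first_reach[OF rate_mono[OF f]])

lemma prim_rec1_parts: "prim_rec1 e" "prim_rec1 f" "prim_rec1 base" "prim_rec1 phase" "prim_rec1 late" "prim_rec1 one_up" "prim_rec1 two_up"
proof -
  show e: "prim_rec1 e" and f: "prim_rec1 f" using rate_e f by (auto intro: rate_prim_rec1)
  show b: "prim_rec1 base"
    unfolding base_def prim_rec1_iff
    by (intro PR_sum PR_if PRP_less PR_Suc PR_const PR_nth PR_nth_tl PR_app1[OF e] PR_app1[OF f]) auto
  show p: "prim_rec1 phase"
  proof (rule prim_rec1_rec)
    show "phase 0 = 0" by simp
    show "phase (Suc v) = (\<lambda>v r. if Suc (Suc (e v)) \<le> f v \<and> ack (Suc (Suc r)) (base v) \<le> v
     then Suc r else r) v (phase v)" for v by simp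
    show "pr2 (\<lambda>v r. if Suc (Suc (e v)) \<le> f v \<and> ack (Suc (Suc r)) (base v) \<le> v then Suc r else r)"
      by (intro PR_if PRP_conj PRP_le PRP_ack_le PR_Suc PR_nth PR_app1[OF e] PR_app1[OF f] PR_app1[OF b]) auto
  qed
  show l: "prim_rec1 late"
    unfolding late_def prim_rec1_iff
    by (intro PR_if PRP_conj PRP_le PRP_ack_le PR_Suc PR_const PR_nth
        PR_app1[OF e] PR_app1[OF f] PR_app1[OF b] PR_app1[OF p]) auto
  show "prim_rec1 one_up"
    unfolding one_up_def prim_rec1_iff by (intro PR_min PR_Suc PR_nth PR_app1[OF e] PR_app1[OF f]) auto
  have "prim_rec1 (\<lambda>_. 0)" unfolding prim_rec1_iff by (rule PR_const)
  then have "prim_rec1 (lead late (\<lambda>_. 0))" by (rule prim_rec1_lead[OF l])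
  then show "prim_rec1 two_up"
    using e unfolding two_up_def prim_rec1_iff by (rule PR_max[rotated])
qed

lemma late_le: "late v \<le> f v" by (simp add: late_def)

lemma two_up_le: "two_up v \<le> f v"
proof -
  have "lead late (\<lambda>_. 0) v \<le> f v"
    using lead_cases[of late "\<lambda>_. 0" v] late_le rate_monoD[OF f, of _ v] by (metis le0 order_trans)
  then show ?thesis using ef by (simp add: two_up_def)
qed

lemma up_in_cone: "one_up \<in> cone k" "two_up \<in> cone k"
proof -
  have unb: "\<exists>v. n \<le> e v" for n using rate_e unfolding rate_def by blast
  have le: "e v \<le> one_up v" "e v \<le> two_up v" for v using ef by (auto simp: one_up_def two_up_def le_SucI)
  have "mono one_up" unfolding one_up_def
    by (intro monoI min.mono) (auto intro: rate_monoD[OF f] rate_monoD[OF rate_e])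
  moreover have "mono two_up" unfolding two_up_def
    by (intro monoI max.mono) (auto intro: monoD[OF lead_mono] rate_monoD[OF rate_e])
  ultimately have "rate one_up" "rate two_up"
    using prim_rec1_parts unb le unfolding rate_def by (meson order_trans)+
  moreover have "one_up v \<le> k v" "two_up v \<le> k v" for v
    using fk[of v] two_up_le[of v] by (auto simp: one_up_def min_le_iff_disj)
  ultimately show "one_up \<in> cone k" "two_up \<in> cone k" by (auto simp: cone_def rle_pointwise)
qed

lemma phase_mono: "mono phase" unfolding mono_iff_le_Suc by auto

text \<open>
  If the phase remained at \<open>j\<close>, then the hypothesis for the pace \<open>ack (j + 2)\<close> would provide a stretch that
  is long enough to increase it.
\<close>

lemma phase_unbounded: "\<exists>v. n \<le> phase v"
proof (rule ccontr)
  assume "\<nexists>v. n \<le> phase v"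
  then have bound: "\<And>v. phase v < n" by (simp add: not_le)
  then have fin: "finite (range phase)" by (auto simp: finite_nat_set_iff_bounded)
  define j where "j = Max (range phase)"
  obtain v0 where v0: "phase v0 = j" using Max_in[OF fin] unfolding j_def by auto
  have j: "phase v = j" if "v0 \<le> v" for v
    using Max_ge[OF fin, of "phase v"] monoD[OF phase_mono that] v0 by (simp add: j_def)
  obtain v where v: "v0 \<le> v" "Suc (Suc (e v)) \<le> f v" "e (ack (Suc (Suc j)) v) = e v"
    using wide[OF pace_ack] by blast
  define w where "w = ack (Suc (Suc j)) v"
  have w: "v \<le> w" "e w = e v" using ack_infl[of v] v(3) by (auto simp: w_def less_imp_le simp del: ack.simps)
  have fw: "Suc (Suc (e w)) \<le> f w" using v(2) w rate_monoD[OF f w(1)] by simp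
  have "base w \<le> v" unfolding base_eq[OF fw] using v(2) w(2) by (auto intro: Least_le)
  then have "ack (Suc (Suc j)) (base w) \<le> w" unfolding w_def by (rule ack_monoD)
  then have "phase (Suc w) = Suc j" using fw j[of w] v(1) w(1) by (simp del: ack.simps)
  then show False using j[of "Suc w"] v(1) w(1) by simp
qed

lemma ack_less_Suc: "ack m v < ack (Suc m) v"
  using ack_twice[of m v] ack_infl[of "ack m v" m] by linarith

text \<open>
  All delays are bounded by one pace \<open>p\<close>, which lies below some level \<open>m\<close>. The first argument \<open>v1\<close> at which a
  phase \<open>j > m\<close> ends marks the end of a stretch of length \<open>ack (j + 2) b\<close>, and throughout it the level in use
  is \<open>j\<close>. There \<open>D1\<close> reaches \<open>n + 1\<close> by time \<open>p b\<close>, as \<open>two_up\<close> has not moved by then, and \<open>D2\<close> reaches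
  \<open>n + 2\<close> by time \<open>p x\<close> with \<open>x = ack j b\<close>. At time \<open>p (p x)\<close>, still on the stretch, \<open>e\<close> is only \<open>n\<close>.
\<close>

lemma no_separation:
  assumes p: "pace p"
    and D1: "\<And>v. one_up v \<le> max (two_up (p v)) (D1 (p v))" and D2: "\<And>v. two_up v \<le> max (one_up (p v)) (D2 (p v))"
    and min: "\<And>v. min (D1 v) (D2 v) \<le> e (p v)" and mono: "mono D1"
  shows False
proof -
  obtain m where m: "\<And>v. p v \<le> ack m v" using prim_rec1_below_ack[OF paceD(1)[OF p]] by blast
  obtain v0 where v0: "Suc m \<le> phase v0" using phase_unbounded by blast
  \<comment> \<open>starting from an element of \<open>T\<close> makes sure that the stretch found below
    lies entirely in one phase\<close>
  obtain t0 where t0: "t0 \<in> T" "v0 < t0" using T(2) infinite_nat_iff_unbounded by blast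
  define ready where "ready v \<longleftrightarrow> t0 \<le> v \<and> Suc (Suc (e v)) \<le> f v \<and> ack (Suc (Suc (phase v))) (base v) \<le> v" for v
  have "\<exists>v. ready v"
  proof (rule ccontr)
    assume no: "\<nexists>v. ready v"
    have "phase v = phase t0" if "t0 \<le> v" for v
      using that by (induction v rule: dec_induct) (use no in \<open>auto simp: ready_def simp del: ack.simps\<close>)
    moreover obtain v where "Suc (phase t0) \<le> phase v" using phase_unbounded by blast
    moreover have "phase v \<le> phase (max v t0)" by (rule monoD[OF phase_mono]) simp
    ultimately show False by (metis max.cobounded2 not_less_eq_eq)
  qed
  define v1 where "v1 = (LEAST v. ready v)"
  have v1: "ready v1" unfolding v1_def by (rule LeastI_ex) fact
  have before: "\<not> ready v" if "v < v1" for v using that unfolding v1_def by (rule not_less_Least)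
  define j where "j = phase t0"
  have phase: "phase v = j" if "t0 \<le> v" "v \<le> v1" for v
    using that
  proof (induction v rule: dec_induct)
    case (step v)
    then show ?case using before[of v] by (auto simp: ready_def simp del: ack.simps)
  qed (simp add: j_def)
  have mj: "Suc m \<le> j" using v0 t0(2) monoD[OF phase_mono, of v0 t0] by (simp add: j_def)
  have v1': "t0 \<le> v1" "Suc (Suc (e v1)) \<le> f v1" "ack (Suc (Suc j)) (base v1) \<le> v1"
    using v1 phase[of v1] by (auto simp: ready_def simp del: ack.simps)
  define b where "b = base v1"
  have b: "Suc (Suc (e v1)) \<le> f b" "b \<le> v1"
    using base_eq[OF v1'(2)] v1'(2) by (auto simp: b_def intro: LeastI Least_le)
  obtain t where t: "t \<le> v1" "t \<in> T" "e v1 = k t" "\<And>u. t < u \<Longrightarrow> u \<le> v1 \<Longrightarrow> u \<notin> T"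
    using jump_cases[of k T v1] t0(1) v1'(1) by blast
  define n where "n = e v1"
  have t0t: "t0 \<le> t" using t(4)[of t0] t0(1) v1'(1) by (meson not_le)
  have en: "e w = n" if "t \<le> w" "w \<le> v1" for w
  proof -
    have "e v1 = e w" using that t(4) by (intro jump_const) auto
    then show ?thesis by (simp add: n_def)
  qed
  have tb: "t < b"
  proof (rule ccontr)
    assume "\<not> t < b"
    then have "f b \<le> k t" using fk[of b] rate_monoD[OF k, of b t] by simp
    then show False using b(1) t(3) by simp
  qed
  have base_w: "base w = b" if "b \<le> w" "w \<le> v1" for w
  proof -
    have "e w = e v1" using en[of w] that tb by (simp add: n_def)
    moreover from this have "Suc (Suc (e w)) \<le> f w" using b(1) rate_monoD[OF f that(1)] by simp
    ultimately show ?thesis using base_eq[of w] base_eq[OF v1'(2)] by (simp add: b_def)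
  qed
  define x where "x = ack j b"
  have pj: "p v < ack j v" for v
  proof -
    have "p v \<le> ack m v" by (rule m)
    also have "\<dots> < ack (Suc m) v" by (rule ack_less_Suc)
    also have "\<dots> \<le> ack j v" by (rule ack_level_mono[OF mj])
    finally show ?thesis .
  qed
  have bx: "b < x" unfolding x_def by (rule ack_infl)
  have ppx: "p (p x) \<le> v1"
  proof -
    have "p (p x) \<le> ack j (ack j (ack j b))"
      using pj[of x] pj[of "p x"] ack_monoD[of "p x" "ack j x" j] unfolding x_def by linarith
    also have "\<dots> \<le> ack (Suc j) (ack j (ack j b))" by (rule ack_level_mono) simp
    also have "\<dots> \<le> ack (Suc j) (ack (Suc j) b)" by (rule ack_monoD[OF ack_twice])
    also have "\<dots> \<le> ack (Suc (Suc j)) b" by (rule ack_twice)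
    finally show ?thesis using v1'(3) unfolding b_def by linarith
  qed
  have px: "p x \<le> v1" "x \<le> p x" "x \<le> v1" using ppx paceD(3)[OF p, of "p x"] paceD(3)[OF p, of x] by linarith+
  have pb: "p b < x" unfolding x_def by (rule pj)
  \<comment> \<open>up to \<open>t\<close>, the rate \<open>f\<close> and hence \<open>late\<close> is at most \<open>k t = n\<close>, and after \<open>t\<close>
    a value of \<open>late\<close> above \<open>n\<close> occurs only from \<open>ack j b\<close> on\<close>
  have "two_up (p b) \<le> n"
  proof -
    have w: "late w \<le> n" if "w \<le> p b" for w
    proof (cases "w \<le> t")
      case True
      then have "f w \<le> n" using fk[of w] rate_monoD[OF k True] t(3) by (simp add: n_def)
      then show ?thesis using late_le[of w] by simp
    next
      case False
      show ?thesis
      proof (rule ccontr)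
        assume "\<not> late w \<le> n"
        then have c: "Suc (Suc (e w)) \<le> f w" "ack (phase w) (base w) \<le> w"
          by (auto simp: late_def split: if_splits)
        have wv: "t \<le> w" "w \<le> v1" using False that pb px(3) by auto
        have "b \<le> w"
          using base_eq[OF v1'(2)] c(1) en[OF wv] unfolding b_def n_def by (auto intro: Least_le)
        then have "ack j b \<le> w" using c(2) base_w wv phase[of w] t0t by simp
        then show False using that pb by (simp add: x_def)
      qed
    qed
    have "lead late (\<lambda>_. 0) (p b) \<le> n" using lead_cases[of late "\<lambda>_. 0" "p b"] w by (metis le0)
    moreover have "e (p b) = n" using en[of "p b"] tb paceD(3)[OF p, of b] pb px(3) by simp
    ultimately show ?thesis by (simp add: two_up_def)
  qed
  moreover have "one_up b = Suc n" using en[of b] tb b by (simp add: one_up_def n_def)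
  ultimately have "Suc n \<le> D1 (p b)" using D1[of b] by auto
  also have "\<dots> \<le> D1 (p x)" using bx by (intro monoD[OF mono] paceD(2)[OF p]) simp
  finally have 1: "Suc n \<le> D1 (p x)" .
  have ex: "e x = n" using en[of x] tb bx px(3) by simp
  have "Suc (Suc (e x)) \<le> f x" using b(1) rate_monoD[OF f, of b x] bx ex by (simp add: n_def)
  moreover have "ack (phase x) (base x) \<le> x"
    using base_w[of x] phase[of x] bx px(3) tb t0t by (simp add: x_def)
  ultimately have "late x = Suc (Suc n)" by (simp add: late_def ex)
  then have "Suc (Suc n) \<le> two_up x" using lead_ge[of "\<lambda>_. 0" x late] by (simp add: two_up_def)
  moreover have "one_up (p x) \<le> Suc n" using en[of "p x"] tb bx px by (simp add: one_up_def)
  ultimately have 2: "Suc (Suc n) \<le> D2 (p x)" using D2[of x] by (auto simp: max_def split: if_splits)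
  have "e (p (p x)) = n" using en[of "p (p x)"] tb bx px ppx paceD(3)[OF p, of "p x"] by simp
  then show False using min[of "p x"] 1 2 by simp
qed

lemma not_narrow: "\<not> narrow (cone k) (\<preceq>) e f"
proof
  assume "narrow (cone k) (\<preceq>) e f"
  moreover have "one_up \<preceq> f" "two_up \<preceq> f" using two_up_le by (auto intro: rle_pointwise simp: one_up_def)
  ultimately obtain D1 D2 where D: "D1 \<in> cone k" "D2 \<in> cone k" "one_up \<preceq> (\<lambda>v. max (two_up v) (D1 v))"
    "two_up \<preceq> (\<lambda>v. max (one_up v) (D2 v))" "(\<lambda>v. min (D1 v) (D2 v)) \<preceq> e"
    unfolding narrow_cone[OF k] using up_in_cone by meson
  have r: "rate (\<lambda>v. max (two_up v) (D1 v))" "rate (\<lambda>v. max (one_up v) (D2 v))" "rate D1" "rate D2"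
    using D(1,2) up_in_cone by (auto intro: rate_max dest: coneD)
  obtain g1 where g1: "pace g1" "\<And>v. one_up v \<le> max (two_up (g1 v)) (D1 (g1 v))"
    using rleE[OF D(3) rate_mono[OF r(1)]] by blast
  obtain g2 where g2: "pace g2" "\<And>v. two_up v \<le> max (one_up (g2 v)) (D2 (g2 v))"
    using rleE[OF D(4) rate_mono[OF r(2)]] by blast
  obtain g3 where g3: "pace g3" "\<And>v. min (D1 v) (D2 v) \<le> e (g3 v)"
    using rleE[OF D(5) rate_mono[OF rate_e]] by blast
  define p where "p v = g1 (g2 (g3 v))" for v
  have p: "pace p" unfolding p_def by (intro pace_comp[OF g1(1)] pace_comp[OF g2(1)] g3(1))
  have le: "g1 v \<le> p v" "g2 v \<le> p v" "g3 v \<le> p v" for v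
    using paceD(2,3)[OF g1(1)] paceD(2,3)[OF g2(1)] paceD(3)[OF g3(1)] unfolding p_def
    by (meson order_trans)+
  show False
  proof (rule no_separation[OF p])
    show "one_up v \<le> max (two_up (p v)) (D1 (p v))" for v
      by (rule order_trans[OF g1(2) rate_monoD[OF r(1) le(1)]])
    show "two_up v \<le> max (one_up (p v)) (D2 (p v))" for v
      by (rule order_trans[OF g2(2) rate_monoD[OF r(2) le(2)]])
    show "min (D1 v) (D2 v) \<le> e (p v)" for v
      using g3(2)[of v] rate_monoD[OF rate_e le(3)[of v]] by simp
    show "mono D1" by (rule rate_mono[OF r(3)])
  qed
qed

end

section \<open>Sets that are not slow\<close>

lemma not_slow_close:
  assumes "infinite (- Y)" "prim_rec_set Y" "\<not> slow Y"
  obtains r where "pace r" "\<And>N. \<exists>z\<ge>N. z \<notin> Y \<and> cnt Y z < cnt Y (r z)"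
proof -
  obtain r where r: "prim_rec1 r" "\<not> (MOST n. r (enumerate (- Y) n) < enumerate (- Y) (Suc n))"
    using assms unfolding slow_def by blast
  obtain r' where r': "pace r'" "\<And>v. r v \<le> r' v" by (rule pace_majorant[OF r(1)]) (rule that, auto)
  have "\<exists>z\<ge>N. z \<notin> Y \<and> cnt Y z < cnt Y (r' z)" for N
  proof -
    obtain n where n: "N < n" "enumerate (- Y) (Suc n) \<le> r (enumerate (- Y) n)"
      using r(2) unfolding MOST_nat not_all not_ex not_imp not_less by blast
    let ?z = "enumerate (- Y) n" and ?z' = "enumerate (- Y) (Suc n)"
    have "N \<le> ?z" using le_enumerate[OF assms(1), of n] n(1) by simp
    moreover have "?z \<notin> Y" "?z' \<notin> Y" using enumerate_in_set[OF assms(1)] by auto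
    moreover have "cnt Y ?z < cnt Y ?z'" using \<open>?z' \<notin> Y\<close> enumerate_step[OF assms(1)] by (intro cnt_less)
    moreover have "cnt Y ?z' \<le> cnt Y (r' ?z)" using n(2) r'(2)[of ?z] by (intro cnt_le) simp
    ultimately show ?thesis by (intro exI[of _ ?z]) simp
  qed
  then show ?thesis using that r'(1) by blast
qed

primrec last_mark :: "nat set \<Rightarrow> (nat \<Rightarrow> nat) \<Rightarrow> nat \<Rightarrow> nat" where
  "last_mark B c 0 = 0"
| "last_mark B c (Suc v) = (if Suc v \<in> B \<and> Suc (Suc (c (last_mark B c v))) \<le> c (Suc v) then Suc v
     else last_mark B c v)"

text \<open>
  The marks are chosen greedily from \<open>B\<close>, each as soon as \<open>c\<close> has grown by two since the previous one. So
  membership depends on the past only and remains primitive recursive.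
\<close>

definition marks :: "nat set \<Rightarrow> (nat \<Rightarrow> nat) \<Rightarrow> nat set" where
  "marks B c = {v. v \<in> B \<and> Suc (Suc (c (last_mark B c (v - 1)))) \<le> c v \<and> 0 < v}"

lemma last_mark_ge: "s \<in> marks B c \<Longrightarrow> s \<le> v \<Longrightarrow> s \<le> last_mark B c v"
proof (induction v)
  case (Suc v)
  then show ?case by (cases "s = Suc v") (auto simp: marks_def)
qed (simp add: marks_def)

lemma marks_apart:
  assumes "mono c" "s \<in> marks B c" "t \<in> marks B c" "s < t"
  shows "Suc (Suc (c s)) \<le> c t"
proof -
  have "c s \<le> c (last_mark B c (t - 1))"
    using assms by (intro monoD[OF assms(1)] last_mark_ge) auto
  then show ?thesis using assms(3) by (simp add: marks_def)
qed

lemma marks_infinite: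
  assumes c: "rate c" and B: "infinite B" shows "infinite (marks B c)"
proof
  assume fin: "finite (marks B c)"
  then obtain N where N: "\<And>s. s \<in> marks B c \<Longrightarrow> s \<le> N"
    unfolding finite_nat_set_iff_bounded_le by blast
  have stuck: "last_mark B c v = last_mark B c N" if "N \<le> v" for v
    using that
  proof (induction v rule: dec_induct)
    case (step v)
    have "Suc v \<notin> marks B c" using N[of "Suc v"] step by auto
    then show ?case using step by (auto simp: marks_def)
  qed simp
  obtain v where v: "Suc (Suc (c (last_mark B c N))) \<le> c v" "N \<le> v" using rate_unbounded[OF c] by blast
  obtain s where s: "s \<in> B" "v < s" using B infinite_nat_iff_unbounded by blast
  have "last_mark B c (s - 1) = last_mark B c N" using stuck[of "s - 1"] s v by simp
  moreover have "c v \<le> c s" using s by (intro rate_monoD[OF c]) simp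
  ultimately have "s \<in> marks B c" using s v by (simp add: marks_def)
  then show False using N[of s] s v by simp
qed

lemma prim_rec_set_marks:
  assumes c: "prim_rec1 c" and B: "prim_rec_set B" shows "prim_rec_set (marks B c)"
proof -
  have last: "prim_rec1 (last_mark B c)"
  proof (rule prim_rec1_rec)
    show "last_mark B c (Suc v) = (\<lambda>v r. if Suc v \<in> B \<and> Suc (Suc (c r)) \<le> c (Suc v) then Suc v else r)
      v (last_mark B c v)" for v by simp
    show "pr2 (\<lambda>v r. if Suc v \<in> B \<and> Suc (Suc (c r)) \<le> c (Suc v) then Suc v else r)"
      by (intro PR_if PRP_conj PRP_in PRP_le PR_Suc PR_nth PR_app1[OF c] B) auto
  qed simp
  show ?thesis
    unfolding prim_rec_set_def prim_rec1_iff marks_def mem_Collect_eq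
    by (intro PR_if PRP_conj PRP_in PRP_le PRP_less PR_Suc PR_diff PR_const PR_nth PR_app1[OF c]
        PR_app1[OF last] B) auto
qed

text \<open>
  With the counting function of a slow set as the clock, marks are farther apart than any pace. After a
  mark, at least two elements of the complement of \<open>X\<close> occur until the next mark. The second one comes
  too late to be reached from the first one, let alone from the mark before it.
\<close>

lemma marks_sparse:
  assumes X: "slow X" and g: "pace g"
  shows "\<exists>N. \<forall>s\<in>marks B (cnt X). N \<le> s \<longrightarrow> (\<forall>w. s < w \<and> w \<le> g s \<longrightarrow> w \<notin> marks B (cnt X))"
proof -
  obtain N where N: "\<And>z. N \<le> z \<Longrightarrow> z \<notin> X \<Longrightarrow> cnt X (g z) = cnt X z"
    using slow_gap[OF X g] by blast
  have "t \<notin> marks B (cnt X)" if s: "s \<in> marks B (cnt X)" "N \<le> s" and t: "s < t" "t \<le> g s" for s t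
  proof
    assume "t \<in> marks B (cnt X)"
    then have gap: "Suc (Suc (cnt X s)) \<le> cnt X t" using s t by (intro marks_apart cnt_mono)
    define z where "z = (LEAST z. s < z \<and> z \<notin> X)"
    have "\<exists>z. s < z \<and> z \<notin> X"
      using cnt_const[of s t X] gap t by (metis less_imp_le not_less_eq_eq le_SucI order_refl)
    then have z: "s < z" "z \<notin> X" using LeastI_ex[of "\<lambda>z. s < z \<and> z \<notin> X"] unfolding z_def by auto
    have between: "w \<in> X" if "s < w" "w < z" for w
      using not_less_Least[of w "\<lambda>z. s < z \<and> z \<notin> X"] that unfolding z_def by blast
    obtain y where y: "z = Suc y" using z(1) by (cases z) auto
    have "cnt X y = cnt X s" using z(1) y between by (intro cnt_const) auto
    then have "cnt X z = Suc (cnt X s)" using y z(2) by simp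
    moreover have "cnt X t \<le> cnt X (g z)"
      using t(2) z(1) paceD(2)[OF g, of s z] by (intro cnt_le) simp
    moreover have "cnt X (g z) = cnt X z" using N[of z] z s(2) by simp
    ultimately show False using gap by simp
  qed
  then show ?thesis by blast
qed

text \<open>
  The value \<open>cnt (- M) v\<close> is the number of elements of \<open>M\<close> up to \<open>v\<close>, so the condition selects every other
  interval between consecutive elements of \<open>M\<close>. There \<open>k\<close> is followed, and on the remaining intervals
  the rate rests at its value on entering.
\<close>

definition alternate :: "(nat \<Rightarrow> nat) \<Rightarrow> nat set \<Rightarrow> bool \<Rightarrow> nat \<Rightarrow> nat" where
  "alternate k M p v = (if even (cnt (- M) v) = p then k v else jump k M v)"

lemma jump_le_alternate: "mono k \<Longrightarrow> jump k M v \<le> alternate k M p v"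
  by (simp add: alternate_def jump_le)

lemma alternate_le: "mono k \<Longrightarrow> alternate k M p v \<le> k v"
  by (simp add: alternate_def jump_le)

lemma alternate_at: "s \<in> M \<Longrightarrow> alternate k M p s = k s"
  by (simp add: alternate_def jump_at)

lemma alternate_in_cone:
  assumes k: "rate k" and M: "prim_rec_set M" "infinite M"
  shows "alternate k M p \<in> cone k"
proof -
  have cM: "prim_rec_set (- M)"
    unfolding prim_rec_set_def prim_rec1_iff Compl_iff
    by (intro PR_if PRP_not PRP_in PR_const PR_nth M(1)) simp
  have "prim_rec1 (alternate k M p)"
    unfolding alternate_def prim_rec1_iff even_iff_mod_2_eq_zero
    by (cases p; simp; intro PR_if PRP_eq PRP_less PR_mod PR_const PR_nth PR_app1[OF prim_rec1_cnt[OF cM]]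
        PR_app1[OF rate_prim_rec1[OF k]] PR_app1[OF prim_rec1_jump[OF rate_prim_rec1[OF k] M(1)]]; simp)
  moreover have "mono (alternate k M p)"
    unfolding mono_iff_le_Suc
  proof
    fix v
    show "alternate k M p v \<le> alternate k M p (Suc v)"
    proof (cases "Suc v \<in> M")
      case True
      then show ?thesis
        using alternate_le[OF rate_mono[OF k], of M p v] rate_monoD[OF k, of v "Suc v"] by (simp add: alternate_at)
    next
      case False
      then show ?thesis
        using rate_monoD[OF k, of v "Suc v"] monoD[OF jump_mono[OF rate_mono[OF k]], of v "Suc v" M]
        by (simp add: alternate_def)
    qed
  qed
  moreover have "\<exists>v. n \<le> alternate k M p v" for n
    using rate_jump[OF k M] jump_le_alternate[OF rate_mono[OF k]] unfolding rate_def by (meson order_trans)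
  ultimately show ?thesis using alternate_le[OF rate_mono[OF k]] by (simp add: cone_def rate_def rle_pointwise)
qed

lemma parity_marks:
  assumes "infinite M" shows "\<exists>s\<in>M. N \<le> s \<and> even (cnt (- M) s) = p"
proof -
  have large: "\<exists>t. s < t \<and> t \<in> M" for s using assms infinite_nat_iff_unbounded by blast
  obtain s where s: "N < s" "s \<in> M" using large by blast
  define t where "t = (LEAST t. s < t \<and> t \<in> M)"
  have t: "s < t" "t \<in> M" using LeastI_ex[OF large[of s]] unfolding t_def by auto
  have between: "w \<notin> M" if "s < w" "w < t" for w
    using not_less_Least[of w "\<lambda>t. s < t \<and> t \<in> M"] that unfolding t_def by blast
  obtain y where y: "t = Suc y" using t(1) by (cases t) auto
  have "cnt (- M) y = cnt (- M) s" using t(1) y between by (intro cnt_const) auto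
  then have "cnt (- M) t = Suc (cnt (- M) s)" using y t(2) by simp
  then have "even (cnt (- M) s) = p \<or> even (cnt (- M) t) = p" by auto
  then show ?thesis using s t by (meson less_imp_le less_trans)
qed

text \<open>
  Let \<open>k = cnt Y\<close> and let \<open>M\<close> be a set of marks \<open>s\<close> that are sparse, while the element of the
  complement of \<open>Y\<close> after \<open>s\<close> is within reach \<open>r s\<close>. The two alternating rates \<open>a\<close> and \<open>b\<close> have maximum \<open>k\<close>
  and minimum \<open>jump k M\<close>. Neither is the top, since each rests after every second mark for longer than
  any pace although \<open>k\<close> moves within reach \<open>r\<close>. The minimum is superfluous: what completes it to the top has
  to be right at \<open>r s\<close>, where \<open>jump k M\<close> is already wrong, and this gives the correct value at \<open>s\<close>, too, at the
  cost of the pace \<open>r\<close>.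

  Suppose that \<open>u\<close> and \<open>f\<close> are as in \<open>splits\<close>. As \<open>u\<close> is the least completion of some \<open>c\<close>, it is
  equivalent to \<open>e = jump k T\<close>, where \<open>T\<close> consists of the elements at which \<open>c\<close> is behind \<open>k\<close> even at the
  generous pace \<open>G = g1 \<circ> r\<close>. A mark \<open>s\<close> at which \<open>a\<close> begins to rest is not in \<open>T\<close>, up to finitely many exceptions.
  Otherwise \<open>c\<close> is still behind at \<open>r s\<close>, so \<open>u \<preceq> a\<close> would have to supply the next value while \<open>a\<close>
  rests. Since \<open>f\<close> is not below \<open>a\<close>, it exceeds \<open>a\<close> on such a resting interval, hence it exceeds \<open>k s\<close>. But \<open>e\<close>
  has not even reached \<open>k s\<close> there, as \<open>s\<close> is not in \<open>T\<close> and, because of \<open>e \<preceq> a\<close>, no later element of the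
  interval is. So the step from \<open>e\<close> to \<open>f\<close> has height two for longer than any pace, and it is not narrow.
\<close>

lemma not_splits_if_not_slow:
  assumes X: "slow X" and Y: "infinite (- Y)" "prim_rec_set Y" "\<not> slow Y"
  shows "\<not> splits (cone (cnt Y)) (\<preceq>)"
proof
  let ?k = "cnt Y"
  assume splits: "splits (cone ?k) (\<preceq>)"
  have k: "rate ?k" using Y by (intro rate_cnt)
  note km = rate_mono[OF k]
  obtain r where r: "pace r" "\<And>N. \<exists>z\<ge>N. z \<notin> Y \<and> ?k z < ?k (r z)"
    using not_slow_close[OF Y] by blast
  define B where "B = {z. z \<notin> Y \<and> ?k z < ?k (r z)}"
  have PRk: "PR 1 (\<lambda>xs. ?k (xs ! 0))" using prim_rec1_cnt[OF Y(2)] by (simp add: prim_rec1_iff)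
  have pB: "prim_rec_set B"
    unfolding prim_rec_set_def prim_rec1_iff B_def mem_Collect_eq
    by (intro PR_if PRP_conj PRP_not PRP_in PRP_less PR_const PR_nth PRk PR_delay k r Y) simp
  have "\<exists>z>n. z \<in> B" for n using r(2)[of "Suc n"] unfolding B_def by (auto simp: Suc_le_eq)
  then have infB: "infinite B" using infinite_nat_iff_unbounded by blast
  define M where "M = marks B (cnt X)"
  have kX: "rate (cnt X)" using X by (auto simp: slow_def intro: rate_cnt)
  have pM: "prim_rec_set M" unfolding M_def using pB by (intro prim_rec_set_marks rate_prim_rec1[OF kX])
  have infM: "infinite M" unfolding M_def using kX infB by (rule marks_infinite)
  have MB: "s \<in> B" if "s \<in> M" for s using that by (simp add: M_def marks_def)
  have next_close: "?k s < ?k (r s)" if "s \<in> M" for s using MB[OF that] by (simp add: B_def)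
  have MY: "s \<notin> Y" if "s \<in> M" for s using MB[OF that] by (simp add: B_def)
  have quiet: "\<exists>N. \<forall>s\<in>M. N \<le> s \<longrightarrow> (\<forall>w. s < w \<and> w \<le> g s \<longrightarrow> w \<notin> M)" if "pace g" for g
    unfolding M_def by (rule marks_sparse[OF X that])
  \<comment> \<open>while resting, \<open>alternate\<close> keeps its value until the next mark\<close>
  have alternate_quiet: "alternate ?k M p v = ?k s"
    if "s \<in> M" "s \<le> v" "\<And>w. s < w \<Longrightarrow> w \<le> v \<Longrightarrow> w \<notin> M" "even (cnt (- M) s) \<noteq> p" for p s v
  proof -
    have "cnt (- M) v = cnt (- M) s" using that by (intro cnt_const) auto
    moreover have "jump ?k M v = jump ?k M s" using that by (intro jump_const) auto
    ultimately show ?thesis using that by (simp add: alternate_def jump_at)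
  qed
  have not_top: "\<not> ?k \<preceq> alternate ?k M p" for p
  proof
    assume "?k \<preceq> alternate ?k M p"
    then obtain g where g: "pace g" "\<And>v. ?k v \<le> alternate ?k M p (g v)"
      using rleE[OF _ rate_mono[OF coneD(1)[OF alternate_in_cone[OF k pM infM]]]] by blast
    obtain N where N: "\<And>s w. s \<in> M \<Longrightarrow> N \<le> s \<Longrightarrow> s < w \<Longrightarrow> w \<le> g (r s) \<Longrightarrow> w \<notin> M"
      using quiet[OF pace_comp[OF g(1) r(1)]] by blast
    obtain s where s: "s \<in> M" "N \<le> s" "even (cnt (- M) s) = (\<not> p)" using parity_marks[OF infM] by blast
    have "s \<le> g (r s)" by (rule paceD(3)[OF pace_comp[OF g(1) r(1)]])
    then have "alternate ?k M p (g (r s)) = ?k s" using s N[OF s(1,2)] by (intro alternate_quiet) auto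
    then show False using g(2)[of "r s"] next_close[OF s(1)] by simp
  qed
  have cov: "?k \<preceq> (\<lambda>v. max (alternate ?k M True v) (alternate ?k M False v))"
    by (rule rle_pointwise) (simp add: alternate_def)
  have small: "?k \<preceq> c"
    if c: "c \<in> cone ?k" and le: "?k \<preceq> (\<lambda>v. max (min (alternate ?k M True v) (alternate ?k M False v)) (c v))" for c
  proof -
    have rc: "rate c" using c by (rule coneD)
    have "(\<lambda>v. min (alternate ?k M True v) (alternate ?k M False v)) = jump ?k M"
      using jump_le[OF km, of M] by (auto simp: alternate_def fun_eq_iff)
    then have "?k \<preceq> (\<lambda>v. max (jump ?k M v) (c v))" using le by metis
    then obtain g where g: "pace g" "\<And>v. ?k v \<le> max (jump ?k M (g v)) (c (g v))"
      using rleE[OF _ rate_mono[OF rate_max[OF rate_jump[OF k pM infM] rc]]] by blast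
    obtain N where N: "\<And>s w. s \<in> M \<Longrightarrow> N \<le> s \<Longrightarrow> s < w \<Longrightarrow> w \<le> g (r s) \<Longrightarrow> w \<notin> M"
      using quiet[OF pace_comp[OF g(1) r(1)]] by blast
    obtain s0 where s0: "s0 \<in> M" "N < s0" using infM infinite_nat_iff_unbounded by blast
    have "?k v \<le> c (g (r (g v)))" if v: "s0 \<le> v" for v
    proof -
      have "s0 \<le> g v" using v paceD(3)[OF g(1), of v] by simp
      then obtain s where s: "s \<le> g v" "s \<in> M" "jump ?k M (g v) = ?k s" "\<And>u. s < u \<Longrightarrow> u \<le> g v \<Longrightarrow> u \<notin> M"
        using jump_cases[of ?k M "g v"] s0(1) by blast
      have "s0 \<le> s" using s(4)[of s0] s0(1) \<open>s0 \<le> g v\<close> by (meson not_le)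
      then have Ns: "N \<le> s" using s0(2) by simp
      show ?thesis
      proof (cases "?k v \<le> ?k s")
        case True
        have "s \<le> g (r s)" by (rule paceD(3)[OF pace_comp[OF g(1) r(1)]])
        then have "jump ?k M (g (r s)) = jump ?k M s" using N[OF s(2) Ns] by (intro jump_const) auto
        then have "jump ?k M (g (r s)) < ?k (r s)" using next_close[OF s(2)] s(2) by (simp add: jump_at)
        then have "?k (r s) \<le> c (g (r s))" using g(2)[of "r s"] by auto
        also have "\<dots> \<le> c (g (r (g v)))"
          using s(1) by (intro rate_monoD[OF rc] paceD(2)[OF g(1)] paceD(2)[OF r(1)])
        finally show ?thesis using next_close[OF s(2)] True by simp
      next
        case False
        then have "?k v \<le> c (g v)" using g(2)[of v] s(3) by auto
        also have "\<dots> \<le> c (g (r (g v)))" by (rule rate_monoD[OF rc paceD(3)[OF pace_comp[OF g(1) r(1)]]])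
        finally show ?thesis .
      qed
    qed
    then show ?thesis
      by (rule rle_eventually[OF k rc pace_comp[OF g(1) pace_comp[OF r(1) g(1)]]])
  qed
  define a where "a = alternate ?k M True"
  have a: "a \<in> cone ?k" unfolding a_def by (rule alternate_in_cone[OF k pM infM])
  have ra: "rate a" using a by (rule coneD)
  have b: "alternate ?k M False \<in> cone ?k" by (rule alternate_in_cone[OF k pM infM])
  have "covers (cone ?k) (\<preceq>) a (alternate ?k M False) \<and> small_inf (cone ?k) (\<preceq>) a (alternate ?k M False)
    \<and> \<not> is_top (cone ?k) (\<preceq>) a \<and> \<not> is_top (cone ?k) (\<preceq>) (alternate ?k M False)"
    using cov small not_top a b unfolding a_def
    by (auto simp: covers_cone[OF k] small_inf_cone[OF k] is_top_cone[OF k])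
  then obtain u f where u: "u \<in> cone ?k" and f: "f \<in> cone ?k" and reg: "regular (cone ?k) (\<preceq>) u"
    and ua: "u \<preceq> a" and uf: "u \<preceq> f" and fa: "\<not> f \<preceq> a" and nar: "narrow (cone ?k) (\<preceq>) u f"
    using splits a b unfolding splits_def by blast
  have ru: "rate u" and rf: "rate f" using u f by (auto dest: coneD)
  obtain c where c: "c \<in> cone ?k" "\<not> ?k \<preceq> c" "?k \<preceq> (\<lambda>v. max (u v) (c v))"
    and least: "\<And>w. w \<in> cone ?k \<Longrightarrow> ?k \<preceq> (\<lambda>v. max (w v) (c v)) \<Longrightarrow> u \<preceq> w"
    using reg unfolding regular_cone[OF k u] by blast
  have rc: "rate c" using c by (auto dest: coneD)
  obtain g1 where g1: "pace g1" "\<And>v. ?k v \<le> max (u (g1 v)) (c (g1 v))"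
    using rleE[OF c(3) rate_mono[OF rate_max[OF ru rc]]] by blast
  define G where "G v = g1 (r v)" for v
  have G: "pace G" unfolding G_def by (rule pace_comp[OF g1(1) r(1)])
  define T where "T = {z. z \<notin> Y \<and> c (G z) < ?k z}"
  have pT: "prim_rec_set T"
    unfolding prim_rec_set_def prim_rec1_iff T_def mem_Collect_eq
    by (intro PR_if PRP_conj PRP_not PRP_in PRP_less PR_const PR_nth PRk PR_delay rc G Y) simp
  have infT: "infinite T"
  proof
    assume "finite T"
    then obtain N where "\<And>z. z \<in> T \<Longrightarrow> z < N" unfolding finite_nat_set_iff_bounded by blast
    then have "?k z \<le> c (G z)" if "N \<le> z" "z \<notin> Y" for z using that by (force simp: T_def)
    then have "?k \<preceq> c" by (rule rle_on_elements[OF k rc G])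
    then show False using c(2) by blast
  qed
  define e where "e = jump ?k T"
  have e: "e \<in> cone ?k" unfolding e_def by (rule jump_in_cone[OF k pT infT])
  have re: "rate e" using e by (rule coneD)
  have "u \<preceq> e"
  proof (rule least[OF e], rule rleI[OF G])
    fix v
    show "?k v \<le> max (e (G v)) (c (G v))"
    proof (cases "?k v = 0")
      case False
      then obtain z where z: "z \<le> v" "z \<notin> Y" "?k z = ?k v" using last_element[of Y v] by auto
      show ?thesis
      proof (cases "z \<in> T")
        case True
        then have "?k z \<le> e (G v)"
          unfolding e_def using z(1) paceD(3)[OF G, of v] by (intro jump_ge[OF km]) auto
        then show ?thesis using z(3) by simp
      next
        case False
        then have "?k z \<le> c (G z)" using z(2) by (simp add: T_def not_less)
        also have "\<dots> \<le> c (G v)" using z(1) by (intro rate_monoD[OF rc] paceD(2)[OF G])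
        finally show ?thesis using z(3) by simp
      qed
    qed simp
  qed
  have g1G: "g1 v \<le> G v" for v unfolding G_def by (intro paceD(2)[OF g1(1)] paceD(3)[OF r(1)])
  have "e \<preceq> u"
  proof (rule rleI[OF g1(1)])
    fix v
    show "e v \<le> u (g1 v)"
    proof (cases "e v = 0")
      case False
      then obtain z where z: "z \<le> v" "z \<in> T" "e v = ?k z" using jump_cases[of ?k T v] unfolding e_def by auto
      have "c (g1 z) \<le> c (G z)" by (rule rate_monoD[OF rc g1G])
      then have "c (g1 z) < ?k z" using z(2) by (simp add: T_def)
      then have "?k z \<le> u (g1 z)" using g1(2)[of z] by auto
      also have "\<dots> \<le> u (g1 v)" using z(1) by (intro rate_monoD[OF ru] paceD(2)[OF g1(1)])
      finally show ?thesis using z(3) by simp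
    qed simp
  qed
  obtain h1 where h1: "pace h1" "\<And>v. u v \<le> a (h1 v)" using rleE[OF ua rate_mono[OF ra]] by blast
  obtain h where h: "pace h" "\<And>v. e v \<le> a (h v)"
    using rleE[OF rle_trans[OF \<open>e \<preceq> u\<close> ua] rate_mono[OF ra]] by blast
  obtain N1 where N1: "\<And>s w. s \<in> M \<Longrightarrow> N1 \<le> s \<Longrightarrow> s < w \<Longrightarrow> w \<le> h1 (G s) \<Longrightarrow> w \<notin> M"
    using quiet[OF pace_comp[OF h1(1) G]] by blast
  \<comment> \<open>the odd marks are those at which \<open>a\<close> begins to rest\<close>
  have odd_mark: "s \<notin> T" if s: "s \<in> M" "N1 \<le> s" "odd (cnt (- M) s)" for s
  proof
    assume "s \<in> T"
    then have "c (g1 (r s)) < ?k (r s)" using next_close[OF s(1)] by (simp add: T_def G_def)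
    then have "?k (r s) \<le> u (g1 (r s))" using g1(2)[of "r s"] by auto
    also have "\<dots> \<le> a (h1 (G s))" using h1(2)[of "g1 (r s)"] by (simp add: G_def)
    also have "\<dots> = ?k s"
      unfolding a_def using s N1[OF s(1,2)] paceD(3)[OF pace_comp[OF h1(1) G], of s]
      by (intro alternate_quiet) auto
    finally show False using next_close[OF s(1)] by simp
  qed
  \<comment> \<open>after an odd mark, an element of \<open>T\<close> occurs only when the next mark is within reach \<open>h\<close>\<close>
  have zone: "\<exists>w\<in>M. s < w \<and> w \<le> h z" if s: "s \<in> M" "odd (cnt (- M) s)" and z: "z \<in> T" "s < z" for s z
  proof (rule ccontr)
    assume no: "\<not> (\<exists>w\<in>M. s < w \<and> w \<le> h z)"
    have "?k z = e z" unfolding e_def using z(1) by (simp add: jump_at)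
    also have "\<dots> \<le> a (h z)" by (rule h(2))
    also have "\<dots> = ?k s"
      unfolding a_def using s no z(2) paceD(3)[OF h(1), of z] by (intro alternate_quiet) auto
    finally show False using cnt_less[of s z Y] z by (simp add: T_def)
  qed
  \<comment> \<open>between \<open>e\<close> and \<open>k\<close> also pointwise, and equivalent to \<open>f\<close>\<close>
  define f' where "f' v = max (e v) (min (f v) (?k v))" for v
  have rf': "rate f'" unfolding f'_def by (intro rate_max rate_min re rf k)
  have fmin: "f \<preceq> (\<lambda>v. min (f v) (?k v))" using f by (intro rle_min rle_refl rate_mono[OF rf] km coneD)
  have ff': "f \<preceq> f'"
    by (rule rle_trans[OF fmin rle_pointwise]) (simp add: f'_def)
  have f'f: "f' \<preceq> f"
    unfolding f'_def
    by (intro max_rle rle_trans[OF \<open>e \<preceq> u\<close> uf] rate_mono[OF rf] rle_pointwise) simp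
  have f'k: "f' v \<le> ?k v" for v using jump_le[OF km, of T v] by (simp add: f'_def e_def)
  have "\<exists>v\<ge>N. Suc (Suc (e v)) \<le> f' v \<and> e (g v) = e v" if g: "pace g" for g N
  proof -
    obtain s0 where s0: "s0 \<in> M" "max N N1 < s0" using infM infinite_nat_iff_unbounded by blast
    have "\<not> f' \<preceq> a" using fa rle_trans[OF ff'] by blast
    then obtain v where v: "s0 \<le> v" "a (h (g v)) < f' v"
      using not_rle_eventually[OF rf' ra _ pace_comp[OF h(1) g]] by blast
    have vhg: "v \<le> h (g v)" by (rule paceD(3)[OF pace_comp[OF h(1) g]])
    obtain s where s: "s \<le> v" "s \<in> M" "\<And>w. s < w \<Longrightarrow> w \<le> v \<Longrightarrow> w \<notin> M"
      using jump_cases[of ?k M v] s0(1) v(1) by blast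
    have "s0 \<le> s" using s(3)[of s0] s0(1) v(1) by (meson not_le)
    \<comment> \<open>the next mark would let \<open>a\<close> catch up with \<open>k\<close>, hence with \<open>f'\<close>\<close>
    have none: "w \<notin> M" if w: "s < w" "w \<le> h (g v)" for w
    proof
      assume wM: "w \<in> M"
      then have "v < w" using s(3)[of w] w(1) by (meson not_le)
      have "f' v \<le> ?k w" using f'k[of v] cnt_le[of v w Y] \<open>v < w\<close> by simp
      also have "\<dots> = a w" unfolding a_def using wM by (simp add: alternate_at)
      also have "\<dots> \<le> a (h (g v))" by (rule rate_monoD[OF ra w(2)])
      finally show False using v(2) by simp
    qed
    have odd: "odd (cnt (- M) s)"
    proof
      assume even: "even (cnt (- M) s)"
      have "cnt (- M) v = cnt (- M) s" using s by (intro cnt_const) auto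
      then have "a v = ?k v" using even by (simp add: a_def alternate_def)
      then show False using v(2) f'k[of v] rate_monoD[OF ra vhg] by simp
    qed
    have "s \<le> h (g v)" using s(1) vhg by simp
    then have "a (h (g v)) = ?k s" unfolding a_def using s(2) none odd by (intro alternate_quiet) auto
    then have f'v: "Suc (?k s) \<le> f' v" using v(2) by simp
    have T_late: "w \<notin> T" if w: "s < w" "w \<le> g v" for w
      using zone[OF s(2) odd _ w(1)] none paceD(2)[OF h(1) w(2)] by (meson order_trans)
    have "s \<notin> T" using odd_mark[OF s(2) _ odd] \<open>s0 \<le> s\<close> s0(2) by simp
    have "e v < ?k s"
    proof (cases "e v = 0")
      case True
      then show ?thesis using cnt_pos[OF MY[OF s(2)]] by simp
    next
      case False
      then obtain z where z: "z \<le> v" "z \<in> T" "e v = ?k z" using jump_cases[of ?k T v] unfolding e_def by auto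
      have "z \<le> s" using T_late[of z] z paceD(3)[OF g, of v] by (meson not_le order_trans)
      then have "z < s" using z(2) \<open>s \<notin> T\<close> by (metis le_neq_implies_less)
      then show ?thesis using cnt_less[OF _ MY[OF s(2)]] z(3) by simp
    qed
    moreover have "e (g v) = e v"
      unfolding e_def using T_late s(1) by (intro jump_const paceD(3)[OF g]) auto
    ultimately show ?thesis
      using f'v v(1) s0(2) by (intro exI[of _ v]) auto
  qed
  then have "wide ?k T f'"
    using k pT infT rf' f'k by unfold_locales (auto simp: e_def f'_def)
  then have "\<not> narrow (cone ?k) (\<preceq>) e f'" unfolding e_def by (rule wide.not_narrow)
  moreover have "narrow (cone ?k) (\<preceq>) e f'"
    using nar unfolding narrow_cone[OF k]
    by (meson \<open>u \<preceq> e\<close> f'f rle_trans)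
  ultimately show False by blast
qed

section \<open>Lower cones of slow and of other sets\<close>

theorem corollary9p23:
  fixes X Y :: "nat set"
  assumes "infinite (- X)" and "prim_rec_set X"
    and "infinite (- Y)" and "prim_rec_set Y"
    and "slow X" and "\<not> slow Y"
  shows "\<not> (\<exists>h. poset_iso deg_le (lowercone X) deg_le (lowercone Y) h)"
proof
  assume "\<exists>h. poset_iso deg_le (lowercone X) deg_le (lowercone Y) h"
  then obtain h where iso: "poset_iso deg_le (lowercone X) deg_le (lowercone Y) h" ..
  have h: "h ` lowercone X = lowercone Y"
    using iso by (simp add: poset_iso_def bij_betw_def)
  have ord: "deg_le (h a) (h b) \<longleftrightarrow> deg_le a b" if "a \<in> lowercone X" "b \<in> lowercone X" for a b
    using iso that by (simp add: poset_iso_def)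
  have cone: "splits (lowercone Z) deg_le \<longleftrightarrow> splits (cone (cnt Z)) (\<preceq>)" if "prim_rec_set Z" for Z
    unfolding lowercone_eq_image[OF that]
    by (rule splits_image) (simp add: deg_le_set_of_rate_iff coneD(1))
  have "splits (lowercone Y) deg_le \<longleftrightarrow> splits (lowercone X) deg_le"
    unfolding h[symmetric] using ord by (rule splits_image)
  moreover have "splits (lowercone X) deg_le" using splits_if_slow[OF assms(5)] cone[OF assms(2)] by simp
  moreover have "\<not> splits (lowercone Y) deg_le"
    using not_splits_if_not_slow[OF assms(5,3,4,6)] cone[OF assms(4)] by simp
  ultimately show False by simp
qed

end
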